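(* The only topographical groups which are normal subgroups of $\Pi=\mathrm{PGL}_2(\mathbb{Z})$ are $G:=\Gamma^3=\langle\gamma_1,\gamma_2,\gamma_3\rangle$ and $P:=\Pi(2)=\langle\rho_1,\rho_2,\rho_3\rangle$, where $$\gamma_1=\begin{pmatrix}-1&2\\-1&1\end{pmatrix},\ \gamma_2=\begin{pmatrix}1&-1\\2&-1\end{pmatrix},\ \gamma_3=\begin{pmatrix}0&1\\-1&0\end{pmatrix},\ \rho_1=\begin{pmatrix}-1&0\\0&1\end{pmatrix},\ \rho_2=\begin{pmatrix}-1&2\\0&1\end{pmatrix},\ \rho_3=\begin{pmatrix}-1&0\\2&1\end{pmatrix}.$$
   Context: $\Gamma=\mathrm{PSL}_2(\mathbb{Z})$; $\Gamma^3$ is the subgroup of $\Gamma$ generated by cubes of elements of $\Gamma$; $\Pi(2)$ is the principal congruence subgroup of level $2$ of $\Pi=\mathrm{PGL}_2(\mathbb{Z})$ (kernel of reduction mod $2$). A superbasis is an unordered triple $\{a,b,c\}$ of points of $\widehat{\mathbb{Q}}=\mathbb{P}^1(\mathbb{Q})$ such that, writing them in lowest terms $a=a_1/a_2$, etc., each pair of the corresponding primitive vectors forms a basis of $\mathbb{Z}^2$. Conway's topograph is the graph whose vertices are superbases, two being adjacent when they share two of their three elements (it is a tree of valence three). Let $\phi:\Pi\to\{\text{superbases}\}$ send a matrix with columns $(a_1,a_2)^t,(b_1,b_2)^t$ to $\{a_1/a_2,\ b_1/b_2,\ (a_1+b_1)/(a_2+b_2)\}$. A topographical group is a subgroup $H<\Pi$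 such that, for a suitable generating set $S$ of $H$, $\phi$ restricts to a graph isomorphism from the right-multiplication Cayley graph of $(H,S)$ (vertices $H$, edges $\{h,hs\}$, $s\in S$) onto Conway's topograph. *)

theory Defs
  imports
    "HOL-Analysis.Determinants"
    "HOL-Algebra.Coset"
    "HOL-Algebra.Generated_Groups"
    "HOL-Library.Z2"
begin

definition mat2 :: "'a::zero \<Rightarrow> 'a \<Rightarrow> 'a \<Rightarrow> 'a \<Rightarrow> 'a^2^2" where
  "mat2 a b c d = vector [vector [a, b], vector [c, d]]"

definition GL2 :: "('a::comm_ring_1^2^2) monoid" where
  "GL2 = \<lparr>carrier = {A. invertible A}, mult = (**), one = mat 1\<rparr>"

definition scalars :: "('a::comm_ring_1^2^2) set" where
  "scalars = {mat u | u. u dvd 1}"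

definition PGL2 :: "('a::comm_ring_1^2^2) set monoid" where
  "PGL2 = GL2 Mod scalars"

definition proj :: "'a::comm_ring_1^2^2 \<Rightarrow> ('a^2^2) set" where
  "proj A = scalars #>\<^bsub>GL2\<^esub> A"

abbreviation PGL2Z :: "(int^2^2) set monoid" where
  "PGL2Z \<equiv> PGL2"

text \<open>Here \<open>PSL\<^sub>2(\<int>)\<close> is regarded as a subgroup of \<open>PGL\<^sub>2(\<int>)\<close>, namely as the image of
  \<open>SL\<^sub>2(\<int>)\<close>.\<close>

definition PSL2Z :: "(int^2^2) set set" where
  "PSL2Z = proj ` {A. det A = 1}"

definition Gamma_cubes :: "(int^2^2) set set" where
  "Gamma_cubes = generate PGL2Z {X [^]\<^bsub>PGL2Z\<^esub> (3::nat) | X. X \<in> PSL2Z}"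

text \<open>The type \<open>bit\<close> is the field with two elements, and \<open>of_int :: int \<Rightarrow> bit\<close> is reduction
  modulo 2.  On \<open>PGL\<^sub>2(\<int>)\<close> the value does not depend on the chosen representative, so the
  image below is a singleton.\<close>

definition reduction_mod_2 :: "(int^2^2) set \<Rightarrow> (bit^2^2) set" where
  "reduction_mod_2 X = the_elem ((\<lambda>A. proj (map_matrix of_int A)) ` X)"

definition Pi_2 :: "(int^2^2) set set" where
  "Pi_2 = kernel PGL2Z PGL2 reduction_mod_2"

datatype qhat = Finite_Point rat | Infinity

definition point :: "int^2 \<Rightarrow> qhat" where
  "point v = (if v $ 2 = 0 then Infinity else Finite_Point (Fract (v $ 1) (v $ 2)))"

text \<open>A point determines its primitive vector only up to sign; the one with positive second
  coordinate is taken (and \<open>(1, 0)\<close> for \<open>\<infinity> = 1/0\<close>).  The sign is irrelevant to being part of a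
  basis.\<close>

fun primitive_vector :: "qhat \<Rightarrow> int^2" where
  "primitive_vector (Finite_Point r) = (let (p, q) = quotient_of r in vector [p, q])"
| "primitive_vector Infinity = vector [1, 0]"

definition basis_of_Z2 :: "int^2 \<Rightarrow> int^2 \<Rightarrow> bool" where
  "basis_of_Z2 u v \<longleftrightarrow> (\<forall>w. \<exists>!(m, n). w = m *s u + n *s v)"

definition superbasis :: "qhat set \<Rightarrow> bool" where
  "superbasis T \<longleftrightarrow> (\<exists>a b c. T = {a, b, c}
     \<and> basis_of_Z2 (primitive_vector a) (primitive_vector b)
     \<and> basis_of_Z2 (primitive_vector a) (primitive_vector c)
     \<and> basis_of_Z2 (primitive_vector b) (primitive_vector c))"

text \<open>A graph is a pair of a vertex set and a set of edges, an edge being the set of its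
  endpoints (so a loop is a singleton, and there are no multiple edges).\<close>

type_synonym 'a graph = "'a set \<times> 'a set set"

definition graph_iso :: "('a \<Rightarrow> 'b) \<Rightarrow> 'a graph \<Rightarrow> 'b graph \<Rightarrow> bool" where
  "graph_iso f G H \<longleftrightarrow> bij_betw f (fst G) (fst H) \<and> (\<lambda>e. f ` e) ` snd G = snd H"

definition topograph :: "qhat set graph" where
  "topograph = ({T. superbasis T},
     {{T, U} | T U. superbasis T \<and> superbasis U \<and> card (T \<inter> U) = 2})"

definition cayley_graph :: "('g, 'm) monoid_scheme \<Rightarrow> 'g set \<Rightarrow> 'g set \<Rightarrow> 'g graph" where
  "cayley_graph G H S = (H, {{h, h \<otimes>\<^bsub>G\<^esub> s} | h s. h \<in> H \<and> s \<in> S})"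

definition superbasis_of_matrix :: "int^2^2 \<Rightarrow> qhat set" where
  "superbasis_of_matrix A =
     {point (column 1 A), point (column 2 A), point (column 1 A + column 2 A)}"

text \<open>The two representatives \<open>\<plusminus>A\<close> of an element of \<open>PGL\<^sub>2(\<int>)\<close> have the same superbasis.\<close>

definition phi :: "(int^2^2) set \<Rightarrow> qhat set" where
  "phi X = the_elem (superbasis_of_matrix ` X)"

definition topographical :: "(int^2^2) set set \<Rightarrow> bool" where
  "topographical H \<longleftrightarrow> subgroup H PGL2Z \<and>
     (\<exists>S \<subseteq> H. generate PGL2Z S = H \<and> graph_iso phi (cayley_graph PGL2Z H S) topograph)"

definition gamma1 :: "(int^2^2) set" where "gamma1 = proj (mat2 (-1) 2 (-1) 1)"
definition gamma2 :: "(int^2^2) set" where "gamma2 = proj (mat2 1 (-1) 2 (-1))"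
definition gamma3 :: "(int^2^2) set" where "gamma3 = proj (mat2 0 1 (-1) 0)"
definition rho1 :: "(int^2^2) set" where "rho1 = proj (mat2 (-1) 0 0 1)"
definition rho2 :: "(int^2^2) set" where "rho2 = proj (mat2 (-1) 2 0 1)"
definition rho3 :: "(int^2^2) set" where "rho3 = proj (mat2 (-1) 0 2 1)"

end

(* Let K be the stabilizer of the base superbasis {infinity, 0, 1}; it is dihedral of order 6.  Since
   GL_2(Z) acts compatibly on matrices and superbases, phi identifies superbases with left cosets of
   K, and adjacency of phi X and phi Y means that inv X * Y lies in K rho1 K.  As K and rho1 generate
   PGL_2(Z), the topograph is connected, and a subgroup is topographical iff it is a complement of K.

   Let H be a normal complement and write rho1 = h k with h in H and k in K.  The exchange t of the
   two basis vectors lies in K and commutes with rho1, so the commutator of k and t lies in both H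
   and K, whence k commutes with t.  This leaves k = 1 or k = t, that is, rho1 in H or gamma3 in H,
   and the conjugates of either element generate a complement.  Conversely Pi(2) and Gamma^3 are normal
   complements: they meet K trivially by reduction modulo 2 and modulo 3, respectively. *)

theory Submission
  imports Defs
begin

section \<open>General and projective linear groups\<close>

lemma mat2_nth [simp]:
  "mat2 a b c d $ 1 $ 1 = a" "mat2 a b c d $ 1 $ 2 = b"
  "mat2 a b c d $ 2 $ 1 = c" "mat2 a b c d $ 2 $ 2 = d"
  by (simp_all add: mat2_def)

lemma mat2_eta: "mat2 (A $ 1 $ 1) (A $ 1 $ 2) (A $ 2 $ 1) (A $ 2 $ 2) = A"
  by (simp add: vec_eq_iff forall_2)

lemma mat2_cases [cases type]:
  obtains a b c d where "A = mat2 a b c d"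
  using mat2_eta by metis

lemma mat2_eq_iff [simp]:
  "mat2 a b c d = mat2 a' b' c' d' \<longleftrightarrow> a = a' \<and> b = b' \<and> c = c' \<and> d = d'"
  by (auto simp: vec_eq_iff forall_2)

lemma mat2_mult [simp]:
  fixes a :: "'a::comm_ring_1"
  shows "mat2 a b c d ** mat2 a' b' c' d' =
    mat2 (a * a' + b * c') (a * b' + b * d') (c * a' + d * c') (c * b' + d * d')"
  by (simp add: vec_eq_iff forall_2 matrix_matrix_mult_def sum_2)

lemma det_mat2 [simp]: "det (mat2 a b c d) = a * d - b * c"
  by (simp add: det_2)

lemma mat_eq_mat2: "mat u = mat2 u 0 0 u"
  by (simp add: vec_eq_iff forall_2 mat_def)

lemma uminus_mat2 [simp]:
  fixes a :: "'a::comm_ring_1"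
  shows "- mat2 a b c d = mat2 (- a) (- b) (- c) (- d)"
  by (simp add: vec_eq_iff forall_2)

lemma map_matrix_mat2 [simp]: "map_matrix f (mat2 a b c d) = mat2 (f a) (f b) (f c) (f d)"
  by (simp add: vec_eq_iff forall_2)

lemma column_mat2 [simp]:
  "column 1 (mat2 a b c d) = vector [a, c]" "column 2 (mat2 a b c d) = vector [b, d]"
  by (simp_all add: column_def vec_eq_iff forall_2)

text \<open>Determinants multiply; conversely the adjugate divided by the determinant is an inverse.
  The ring is general because both the integers and the field \<open>bit\<close> are needed.\<close>

lemma invertible_iff_det_dvd_1:
  fixes A :: "'a::comm_ring_1^2^2"
  shows "invertible A \<longleftrightarrow> det A dvd 1"
proof
  assume "invertible A"
  then obtain B where "A ** B = mat 1"
    by (auto simp: invertible_def)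
  then have "det A * det B = 1"
    by (metis det_mul det_I)
  then show "det A dvd 1"
    by (metis dvd_triv_left)
next
  assume "det A dvd 1"
  then obtain u where u: "1 = det A * u" by auto
  obtain a b c d where A: "A = mat2 a b c d" by (cases A)
  have "A ** mat2 (u * d) (- (u * b)) (- (u * c)) (u * a) = mat 1"
    "mat2 (u * d) (- (u * b)) (- (u * c)) (u * a) ** A = mat 1"
    using u by (simp_all add: A mat_eq_mat2 algebra_simps)
  then show "invertible A"
    unfolding invertible_def by blast
qed

lemma is_unit_mult: "u dvd 1 \<Longrightarrow> v dvd 1 \<Longrightarrow> u * v dvd 1" for u v :: "'a::comm_monoid_mult"
  using mult_dvd_mono[of u 1 v 1] by simp

section \<open>The general linear group and its quotient by the scalars\<close>

lemma GL2_simps [simp]: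
  "carrier GL2 = {A. invertible A}" "A \<otimes>\<^bsub>GL2\<^esub> B = A ** B" "\<one>\<^bsub>GL2\<^esub> = mat 1"
  by (simp_all add: GL2_def)

lemma group_GL2: "group GL2"
proof (rule groupI)
  fix A :: "'a::comm_ring_1^2^2"
  assume "A \<in> carrier GL2"
  then show "\<exists>B\<in>carrier GL2. B \<otimes>\<^bsub>GL2\<^esub> A = \<one>\<^bsub>GL2\<^esub>"
    by (auto simp: invertible_def)
qed (auto simp: invertible_mult matrix_mul_assoc invertible_iff_det_dvd_1 [of "mat 1"])

lemma mat_mult_commute:
  fixes A :: "'a::comm_ring_1^2^2"
  shows "mat u ** A = A ** mat u"
  by (cases A) (simp add: mat_eq_mat2 mult.commute)

text \<open>Scalar matrices are central, so left and right cosets agree.\<close>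

lemma normal_scalars: "(scalars :: ('a::comm_ring_1^2^2) set) \<lhd> GL2"
proof -
  have "subgroup (scalars :: ('a^2^2) set) GL2"
  proof (rule group.subgroupI[OF group_GL2])
    show "scalars \<subseteq> carrier GL2"
      by (auto simp: scalars_def invertible_iff_det_dvd_1 mat_eq_mat2 intro: is_unit_mult)
    show "scalars \<noteq> {}"
      by (auto simp: scalars_def intro: exI[of _ 1])
  next
    fix A :: "'a^2^2"
    assume "A \<in> scalars"
    then obtain u where A: "A = mat u" "u dvd 1" by (auto simp: scalars_def)
    then obtain v where v: "1 = u * v" by auto
    then have "mat v \<otimes>\<^bsub>GL2\<^esub> A = \<one>\<^bsub>GL2\<^esub>"
      by (simp add: A mat_eq_mat2 mult.commute)
    moreover from v have "v dvd 1"
      by (metis dvd_triv_right)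
    moreover from this have "A \<in> carrier GL2" "mat v \<in> carrier GL2"
      using A by (auto simp: invertible_iff_det_dvd_1 mat_eq_mat2 is_unit_mult)
    ultimately have "inv\<^bsub>GL2\<^esub> A = mat v"
      using group.inv_equality[OF group_GL2] by blast
    then show "inv\<^bsub>GL2\<^esub> A \<in> scalars"
      using \<open>v dvd 1\<close> by (auto simp: scalars_def)
  next
    fix A B :: "'a^2^2"
    assume "A \<in> scalars" "B \<in> scalars"
    then obtain u v where "A = mat u" "u dvd 1" "B = mat v" "v dvd 1"
      by (auto simp: scalars_def)
    moreover from this have "u * v dvd 1" by (simp add: is_unit_mult)
    ultimately show "A \<otimes>\<^bsub>GL2\<^esub> B \<in> scalars"
      by (auto simp: scalars_def mat_eq_mat2)
  qed
  then show ?thesis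
    by (rule group.normalI[OF group_GL2])
      (auto simp: r_coset_def l_coset_def scalars_def mat_mult_commute)
qed

lemma group_PGL2: "group PGL2"
  unfolding PGL2_def by (rule normal.factorgroup_is_group[OF normal_scalars])

lemma carrier_PGL2: "carrier PGL2 = proj ` {A. invertible A}"
  by (simp add: PGL2_def carrier_FactGroup proj_def)

lemma proj_mult:
  "invertible A \<Longrightarrow> invertible B \<Longrightarrow> proj A \<otimes>\<^bsub>PGL2\<^esub> proj B = proj (A ** B)"
  using normal.rcos_sum[OF normal_scalars, of A B] by (simp add: PGL2_def proj_def)

lemma one_PGL2: "\<one>\<^bsub>PGL2\<^esub> = proj (mat 1 :: 'a::comm_ring_1^2^2)"
proof -
  have "scalars #>\<^bsub>GL2\<^esub> \<one>\<^bsub>GL2\<^esub> = (scalars :: ('a^2^2) set)"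
    by (rule group.coset_mult_one[OF group_GL2])
      (rule subgroup.subset[OF normal_imp_subgroup[OF normal_scalars]])
  then show ?thesis
    by (simp add: PGL2_def proj_def)
qed

lemma scalars_int: "scalars = {mat 1, - mat 1 :: int^2^2}"
proof -
  have "mat (- 1) = (- mat 1 :: int^2^2)"
    by (simp add: mat_eq_mat2)
  moreover have "{u :: int. u dvd 1} = {1, - 1}"
    by auto
  then have "scalars = mat ` {1, - 1 :: int}"
    unfolding scalars_def by blast
  ultimately show ?thesis
    by simp
qed

text \<open>Equations in PGL_2(Z) thereby become entrywise equations up to a common sign.\<close>

lemma proj_int: "proj (A :: int^2^2) = {A, - A}"
proof -
  have "- mat 1 ** A = - A"
    by (cases A) (simp add: mat_eq_mat2)
  then show ?thesis
    by (simp add: proj_def r_coset_def scalars_int insert_commute)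
qed

lemma proj_int_eq_iff: "proj A = proj B \<longleftrightarrow> A = B \<or> A = - B" for A B :: "int^2^2"
  by (auto simp: proj_int doubleton_eq_iff)

section \<open>Superbases\<close>

lemma invertible_int_iff: "invertible A \<longleftrightarrow> det A = 1 \<or> det A = - 1" for A :: "int^2^2"
  by (auto simp: invertible_iff_det_dvd_1)

text \<open>The determinant with columns \<open>u\<close> and \<open>v\<close>: value 0 means linear
  dependence, absolute value 1 a basis of Z^2.\<close>

definition wedge :: "int^2 \<Rightarrow> int^2 \<Rightarrow> int" where
  "wedge u v = u $ 1 * v $ 2 - u $ 2 * v $ 1"

lemma vec2_eq_0_iff: "v = 0 \<longleftrightarrow> v $ 1 = 0 \<and> v $ 2 = 0" for v :: "'a::zero^2"
  by (simp add: vec_eq_iff forall_2)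

text \<open>Cross multiplication of fractions. The zero vector is excluded because
  \<open>point\<close> sends it to \<open>Infinity\<close>.\<close>

lemma point_eq_iff:
  assumes "u \<noteq> 0" "v \<noteq> 0"
  shows "point u = point v \<longleftrightarrow> wedge u v = 0"
  using assms by (auto simp: point_def wedge_def vec2_eq_0_iff eq_rat mult.commute)

lemma coprime_primitive_vector: "coprime (primitive_vector p $ 1) (primitive_vector p $ 2)"
  by (cases p) (auto dest: quotient_of_coprime split: prod.splits)

lemma point_primitive_vector [simp]: "point (primitive_vector p) = p"
proof (cases p)
  case (Finite_Point r)
  obtain a b where "quotient_of r = (a, b)" by force
  moreover from this have "b > 0" "r = Fract a b"
    by (simp_all add: quotient_of_denom_pos quotient_of_div Fract_of_int_quotient)
  ultimately show ?thesis
    by (simp add: Finite_Point point_def)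
qed (simp add: point_def)

lemma coprime_imp_nonzero: "coprime (v $ 1) (v $ 2) \<Longrightarrow> v \<noteq> 0" for v :: "int^2"
  by auto

lemmas primitive_vector_nonzero = coprime_imp_nonzero[OF coprime_primitive_vector]

text \<open>A common divisor of the coordinates of either vector divides \<open>wedge u v\<close>,
  hence is a unit.\<close>

lemma coprime_of_wedge:
  assumes "\<bar>wedge u v\<bar> = 1"
  shows "coprime (u $ 1) (u $ 2)" "coprime (v $ 1) (v $ 2)"
proof -
  have "is_unit c" if "c dvd u $ 1" "c dvd u $ 2" for c
    using that assms by (metis (no_types) dvd_diff dvd_mult2 wedge_def dvd_abs_iff)
  moreover have "is_unit c" if "c dvd v $ 1" "c dvd v $ 2" for c
    using that assms by (metis (no_types) dvd_diff dvd_mult wedge_def dvd_abs_iff)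
  ultimately show "coprime (u $ 1) (u $ 2)" "coprime (v $ 1) (v $ 2)"
    by (auto intro!: coprimeI)
qed

text \<open>Fractions in lowest terms with equal value agree in absolute values; the relation itself
  then forces a common sign.\<close>

lemma wedge_eq_0_imp:
  assumes "coprime (u $ 1) (u $ 2)" "coprime (v $ 1) (v $ 2)" "wedge u v = 0"
  shows "u = v \<or> u = - v"
proof -
  have eq: "u $ 1 * v $ 2 = v $ 1 * u $ 2"
    using assms(3) by (simp add: wedge_def mult.commute)
  then have "\<bar>u $ 1\<bar> * \<bar>v $ 2\<bar> = \<bar>v $ 1\<bar> * \<bar>u $ 2\<bar>"
    by (metis abs_mult)
  then have "\<bar>u $ 1\<bar> = \<bar>v $ 1\<bar>" "\<bar>v $ 2\<bar> = \<bar>u $ 2\<bar>"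
    using coprime_crossproduct_int[of "u $ 1" "u $ 2" "v $ 1" "v $ 2"] assms(1,2)
    by (auto simp: coprime_commute)
  then show ?thesis
    using eq by (auto simp: vec_eq_iff forall_2 abs_eq_iff)
qed

lemma primitive_vector_point:
  assumes "coprime (v $ 1) (v $ 2)"
  shows "primitive_vector (point v) = v \<or> primitive_vector (point v) = - v"
  using assms coprime_primitive_vector primitive_vector_nonzero coprime_imp_nonzero
    point_primitive_vector point_eq_iff wedge_eq_0_imp by metis

lemma wedge_simps [simp]:
  "wedge (- u) v = - wedge u v" "wedge u (- v) = - wedge u v"
  "wedge u u = 0" "wedge u (u + v) = wedge u v" "wedge v (u + v) = - wedge u v"
  by (simp_all add: wedge_def algebra_simps)

text \<open>A change of basis over Z has determinant \<plusminus>1; conversely Cramer's rule yields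
  unique integral coordinates.\<close>

lemma basis_of_Z2_iff: "basis_of_Z2 u v \<longleftrightarrow> \<bar>wedge u v\<bar> = 1"
proof
  assume B: "basis_of_Z2 u v"
  \<comment> \<open>The coordinates of the standard basis form an inverse matrix, so its determinant
    times \<open>wedge u v\<close> is 1.\<close>
  then obtain m n m' n' where "vector [1, 0] = m *s u + n *s v" "vector [0, 1] = m' *s u + n' *s v"
    unfolding basis_of_Z2_def by (metis (mono_tags, lifting) case_prodE)
  then have "1 = m * u $ 1 + n * v $ 1" "0 = m * u $ 2 + n * v $ 2"
    "0 = m' * u $ 1 + n' * v $ 1" "1 = m' * u $ 2 + n' * v $ 2"
    by (auto simp: vec_eq_iff forall_2)
  then have "(m * n' - n * m') * wedge u v = 1"
    unfolding wedge_def by algebra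
  then show "\<bar>wedge u v\<bar> = 1"
    by (metis zmult_eq_1_iff abs_neg_one abs_1)
next
  assume "\<bar>wedge u v\<bar> = 1"
  then have sq: "wedge u v * wedge u v = 1" by (auto simp: abs_if split: if_splits)
  have "\<exists>!(m, n). w = m *s u + n *s v" for w
  \<comment> \<open>Cramer's coefficients: dividing by \<open>wedge u v\<close> is multiplying by
    it, as its square is 1.\<close>
  proof (rule ex1I[of _ "(wedge u v * wedge w v, wedge u v * wedge u w)"])
    show "case (wedge u v * wedge w v, wedge u v * wedge u w) of (m, n) \<Rightarrow> w = m *s u + n *s v"
      using sq unfolding wedge_def by (simp add: vec_eq_iff forall_2) algebra
  next
    fix mn assume "case mn of (m, n) \<Rightarrow> w = m *s u + n *s v"
    then have "w $ 1 = fst mn * u $ 1 + snd mn * v $ 1" "w $ 2 = fst mn * u $ 2 + snd mn * v $ 2"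
      by (auto split: prod.splits)
    then have "fst mn = wedge u v * wedge w v" "snd mn = wedge u v * wedge u w"
      using sq unfolding wedge_def by algebra+
    then show "mn = (wedge u v * wedge w v, wedge u v * wedge u w)"
      by (simp add: prod_eq_iff)
  qed
  then show "basis_of_Z2 u v"
    unfolding basis_of_Z2_def by blast
qed

lemma det_eq_wedge: "det A = wedge (column 1 A) (column 2 A)"
  by (simp add: det_2 wedge_def column_def mult.commute)

lemma point_uminus [simp]: "point (- v) = point v"
  by (cases "v = 0") (simp_all add: point_eq_iff)

text \<open>Three vectors that are pairwise bases satisfy a relation with coefficients
  \<plusminus>1, so suitable signs make the third the sum of the other two.\<close>

lemma superbasis_iff: "superbasis T \<longleftrightarrow> (\<exists>A. invertible A \<and> T = superbasis_of_matrix A)"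
proof
  assume "superbasis T"
  then obtain a b c where T: "T = {a, b, c}"
    and w: "\<bar>wedge (primitive_vector a) (primitive_vector b)\<bar> = 1"
      "\<bar>wedge (primitive_vector a) (primitive_vector c)\<bar> = 1"
      "\<bar>wedge (primitive_vector b) (primitive_vector c)\<bar> = 1"
    unfolding superbasis_def basis_of_Z2_iff by blast
  define u v w where uvw: "u = primitive_vector a" "v = primitive_vector b" "w = primitive_vector c"
  define p q D where pqD: "p = wedge u w" "q = wedge v w" "D = wedge u v"
  have unit: "p = 1 \<or> p = - 1" "q = 1 \<or> q = - 1" "D = 1 \<or> D = - 1"
    using w by (auto simp: uvw pqD abs_if split: if_splits)
  \<comment> \<open>Three vectors in the plane are linearly dependent, with their pairwise
    determinants as coefficients.\<close>
  have "D * w $ 1 = p * v $ 1 - q * u $ 1" "D * w $ 2 = p * v $ 2 - q * u $ 2"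
    unfolding pqD wedge_def by algebra+
  then have "w = u + v \<or> w = - (u + v) \<or> w = u - v \<or> w = - (u - v)"
    using unit by (auto simp: vec_eq_iff forall_2)
  \<comment> \<open>Replacing \<open>v\<close> by \<open>- v\<close> keeps its point and turns a
    difference into a sum.\<close>
  then obtain v' where v': "v' = v \<or> v' = - v" "w = u + v' \<or> w = - (u + v')"
    by (metis diff_conv_add_uminus)
  define A where "A = mat2 (u $ 1) (v' $ 1) (u $ 2) (v' $ 2)"
  have cols: "column 1 A = u" "column 2 A = v'"
    by (simp_all add: A_def vec_eq_iff forall_2)
  have "invertible A"
    using v'(1) unit(3) by (auto simp: invertible_int_iff det_eq_wedge cols pqD)
  moreover have "point v' = b" "point (u + v') = c" "point u = a"
    using v' point_uminus point_primitive_vector uvw by metis+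
  then have "T = superbasis_of_matrix A"
    by (simp add: T superbasis_of_matrix_def cols)
  ultimately show "\<exists>A. invertible A \<and> T = superbasis_of_matrix A" by blast
next
  assume "\<exists>A. invertible A \<and> T = superbasis_of_matrix A"
  then obtain A where A: "invertible A" "T = superbasis_of_matrix A" by blast
  define u v where uv: "u = column 1 A" "v = column 2 A"
  have wuv: "\<bar>wedge u v\<bar> = 1"
    using A(1) by (auto simp: invertible_int_iff det_eq_wedge uv)
  have basis: "basis_of_Z2 (primitive_vector (point x)) (primitive_vector (point y))"
    if "\<bar>wedge x y\<bar> = 1" for x y
    using that primitive_vector_point[OF coprime_of_wedge(1)[OF that]]
      primitive_vector_point[OF coprime_of_wedge(2)[OF that]]
    by (auto simp: basis_of_Z2_iff)
  show "superbasis T"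
    unfolding superbasis_def
    by (rule exI[of _ "point u"], rule exI[of _ "point v"], rule exI[of _ "point (u + v)"])
      (simp add: A(2) superbasis_of_matrix_def uv[symmetric] basis wuv)
qed

section \<open>The action of GL_2(Z) on P^1(Q) by fractional linear maps\<close>

definition act :: "int^2^2 \<Rightarrow> qhat \<Rightarrow> qhat" where
  "act A p = point (A *v primitive_vector p)"

lemma wedge_mult: "wedge (A *v u) (A *v v) = det A * wedge u v"
  by (simp add: wedge_def det_2 matrix_vector_mult_def sum_2 algebra_simps)

lemma invertible_mult_vec_nonzero:
  fixes A :: "int^2^2"
  assumes "invertible A" "v \<noteq> 0"
  shows "A *v v \<noteq> 0"
  using assms unfolding invertible_def
  by (metis matrix_vector_mul_assoc matrix_vector_mul_lid matrix_vector_mult_0_right)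

text \<open>Multiplication by \<open>A\<close> scales \<open>wedge\<close> by \<plusminus>1, so its
  vanishing is preserved.\<close>

lemma point_mult_vec_eq_iff:
  assumes "invertible A" "u \<noteq> 0" "v \<noteq> 0"
  shows "point (A *v u) = point (A *v v) \<longleftrightarrow> point u = point v"
  using assms by (auto simp: point_eq_iff invertible_mult_vec_nonzero wedge_mult invertible_int_iff)

lemma act_point:
  assumes "invertible A" "v \<noteq> 0"
  shows "act A (point v) = point (A *v v)"
  using assms by (simp add: act_def point_mult_vec_eq_iff primitive_vector_nonzero)

lemma inj_act: "invertible A \<Longrightarrow> inj (act A)"
  by (rule injI) (simp add: act_def point_mult_vec_eq_iff primitive_vector_nonzero)

lemma column_mult: "column i (A ** B) = A *v column i B" for A :: "'a::semiring_1^'n^'m"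
  by (simp add: column_def matrix_matrix_mult_def matrix_vector_mult_def vec_eq_iff)

lemma columns_nonzero:
  fixes A :: "int^2^2"
  assumes "invertible A"
  shows "column 1 A \<noteq> 0" "column 2 A \<noteq> 0" "column 1 A + column 2 A \<noteq> 0"
proof -
  have "\<bar>wedge (column 1 A) (column 2 A)\<bar> = 1"
    using assms by (auto simp: invertible_int_iff det_eq_wedge)
  then show "column 1 A \<noteq> 0" "column 2 A \<noteq> 0" "column 1 A + column 2 A \<noteq> 0"
    by (auto simp: wedge_def add_eq_0_iff)
qed

text \<open>The columns of the product and their sum are the images under \<open>A\<close> of those
  of \<open>B\<close>.\<close>

lemma superbasis_of_matrix_mult:
  assumes "invertible A" "invertible B"
  shows "superbasis_of_matrix (A ** B) = act A ` superbasis_of_matrix B"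
  using assms columns_nonzero[OF assms(2)]
  by (simp add: superbasis_of_matrix_def column_mult act_point matrix_vector_right_distrib[symmetric])

lemma phi_proj [simp]: "phi (proj A) = superbasis_of_matrix A"
proof -
  have "column i (- A) = - column i A" for i
    by (simp add: column_def vec_eq_iff)
  then have "superbasis_of_matrix (- A) = superbasis_of_matrix A"
    unfolding superbasis_of_matrix_def by (metis minus_add_distrib point_uminus)
  then show ?thesis
    by (simp add: phi_def proj_int)
qed

section \<open>The stabilizer of the base superbasis\<close>

interpretation PGL2Z: group PGL2Z
  by (rule group_PGL2)

lemma invertible_mat2_int [simp]:
  "invertible (mat2 a b c d :: int^2^2) \<longleftrightarrow> a * d - b * c = 1 \<or> a * d - b * c = - 1"
  by (simp add: invertible_int_iff)

lemma PGL2Z_cases: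
  assumes "X \<in> carrier PGL2Z"
  obtains A where "invertible A" "X = proj A"
  using assms by (auto simp: carrier_PGL2)

lemma proj_in_carrier [simp]: "invertible A \<Longrightarrow> proj A \<in> carrier PGL2"
  by (simp add: carrier_PGL2)

declare proj_mult [simp] proj_int_eq_iff [simp]

text \<open>Up to sign, the columns of these matrices are two of the three vectors
  \<open>e\<^sub>1, e\<^sub>2, - (e\<^sub>1 + e\<^sub>2)\<close>, which are permuted by the group.\<close>

definition stab_mats :: "(int^2^2) set" where
  "stab_mats = {mat2 1 0 0 1, mat2 0 1 1 0, mat2 1 (-1) 0 (-1), mat2 (-1) 1 (-1) 0,
     mat2 0 (-1) 1 (-1), mat2 (-1) 0 (-1) 1}"

definition stab :: "(int^2^2) set set" where
  "stab = proj ` stab_mats"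

lemma stab_subset: "stab \<subseteq> carrier PGL2Z"
  by (auto simp: stab_def stab_mats_def)

lemma base_superbasis: "superbasis_of_matrix (mat 1) = {Infinity, Finite_Point 0, Finite_Point 1}"
  by (simp add: mat_eq_mat2 superbasis_of_matrix_def point_def Fract_of_int_quotient)

text \<open>Both primitive vectors of each of \<infinity>, 0 and 1, as pairs so that case
  distinction gives equations between matrix entries.\<close>

definition base_vectors :: "(int \<times> int) set" where
  "base_vectors = {(1, 0), (-1, 0), (0, 1), (0, -1), (1, 1), (-1, -1)}"

lemma point_in_base_superbasis:
  assumes "coprime (v $ 1) (v $ 2)" "point v \<in> superbasis_of_matrix (mat 1)"
  shows "(v $ 1, v $ 2) \<in> base_vectors"
proof (cases "v $ 2 = 0")
  case True
  then show ?thesis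
    using assms(1) by (auto simp: base_vectors_def abs_if split: if_splits)
next
  case False
  then have "Fract (v $ 1) (v $ 2) = Fract 0 1 \<or> Fract (v $ 1) (v $ 2) = Fract 1 1"
    using assms(2) by (auto simp: base_superbasis point_def Zero_rat_def One_rat_def)
  then have "v $ 1 = 0 \<or> v $ 1 = v $ 2"
    using False by (auto simp: eq_rat)
  then show ?thesis
    using assms(1) by (auto simp: base_vectors_def abs_if split: if_splits)
qed

lemma superbasis_of_matrix_mat2:
  "superbasis_of_matrix (mat2 a b c d) =
    {point (vector [a, c]), point (vector [b, d]), point (vector [a + b, c + d])}"
proof -
  have "vector [a, c] + vector [b, d] = (vector [a + b, c + d] :: int^2)"
    by (simp add: vec_eq_iff forall_2)
  then show ?thesis
    by (simp add: superbasis_of_matrix_def)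
qed

text \<open>Invertibility makes both columns and their sum primitive, so
  \<open>point_in_base_superbasis\<close> applies.\<close>

lemma columns_in_base_superbasis:
  assumes "invertible (mat2 a b c d :: int^2^2)"
  shows "point (vector [a, c]) \<in> superbasis_of_matrix (mat 1) \<Longrightarrow> (a, c) \<in> base_vectors"
    "point (vector [b, d]) \<in> superbasis_of_matrix (mat 1) \<Longrightarrow> (b, d) \<in> base_vectors"
    "point (vector [a + b, c + d]) \<in> superbasis_of_matrix (mat 1) \<Longrightarrow> (a + b, c + d) \<in> base_vectors"
proof -
  have "\<bar>wedge (vector [a, c]) (vector [b, d])\<bar> = 1"
    "\<bar>wedge (vector [a, c]) (vector [a + b, c + d])\<bar> = 1"
    using assms by (auto simp: wedge_def algebra_simps abs_if)
  note coprime = this[THEN coprime_of_wedge(1)] this[THEN coprime_of_wedge(2)]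
  show "point (vector [a, c]) \<in> superbasis_of_matrix (mat 1) \<Longrightarrow> (a, c) \<in> base_vectors"
    "point (vector [b, d]) \<in> superbasis_of_matrix (mat 1) \<Longrightarrow> (b, d) \<in> base_vectors"
    "point (vector [a + b, c + d]) \<in> superbasis_of_matrix (mat 1) \<Longrightarrow> (a + b, c + d) \<in> base_vectors"
    using coprime[THEN point_in_base_superbasis] by simp_all
qed

text \<open>If the superbasis is the base one, both columns and their sum are base vectors; the
  finitely many cases leave only the listed matrices up to sign.\<close>

lemma mem_stab_iff:
  assumes "X \<in> carrier PGL2Z"
  shows "X \<in> stab \<longleftrightarrow> phi X = phi \<one>\<^bsub>PGL2Z\<^esub>"
proof
  assume "X \<in> stab"
  then show "phi X = phi \<one>\<^bsub>PGL2Z\<^esub>"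
    by (auto simp: stab_def stab_mats_def one_PGL2 base_superbasis superbasis_of_matrix_mat2
        point_def Fract_of_int_quotient)
next
  assume phi: "phi X = phi \<one>\<^bsub>PGL2Z\<^esub>"
  obtain a b c d where X: "X = proj (mat2 a b c d)" and inv: "invertible (mat2 a b c d :: int^2^2)"
    using assms by (metis PGL2Z_cases mat2_cases)
  have "superbasis_of_matrix (mat2 a b c d) = superbasis_of_matrix (mat 1)"
    using phi by (simp add: X one_PGL2)
  then have "(a, c) \<in> base_vectors" "(b, d) \<in> base_vectors" "(a + b, c + d) \<in> base_vectors"
    using columns_in_base_superbasis[OF inv] by (auto simp: superbasis_of_matrix_mat2)
  then have "mat2 a b c d \<in> stab_mats \<or> - mat2 a b c d \<in> stab_mats"
    using inv unfolding base_vectors_def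
    by (elim insertE emptyE) (simp_all add: stab_mats_def)
  then show "X \<in> stab"
    unfolding X stab_def using proj_int_eq_iff by blast
qed

section \<open>The neighbours of the base superbasis\<close>

lemma two_of_three:
  assumes "card ({x, y, z} \<inter> B) = 2"
  shows "x \<in> B \<and> y \<in> B \<or> x \<in> B \<and> z \<in> B \<or> y \<in> B \<and> z \<in> B"
proof (rule ccontr)
  assume "\<not> ?thesis"
  then have "{x, y, z} \<inter> B \<subseteq> {x} \<or> {x, y, z} \<inter> B \<subseteq> {y} \<or> {x, y, z} \<inter> B \<subseteq> {z}"
    by auto
  then have "card ({x, y, z} \<inter> B) \<le> 1"
    by (metis card_mono card.empty card_insert_if finite.intros empty_iff One_nat_def)
  then show False using assms by simp
qed

text \<open>\<open>rho1\<close> fixes \<infinity> and 0 and moves 1 to -1, which gives one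
  neighbour; \<open>stab\<close> carries it to all three.\<close>

lemma phi_stab_rho1:
  "(\<lambda>k. phi (k \<otimes>\<^bsub>PGL2Z\<^esub> rho1)) ` stab =
    {{Infinity, Finite_Point 0, Finite_Point (-1)}, {Infinity, Finite_Point 1, Finite_Point 2},
     {Finite_Point 0, Finite_Point 1, Finite_Point (1 / 2)}}"
  by (simp add: stab_def stab_mats_def rho1_def superbasis_of_matrix_mat2 point_def
      Fract_of_int_quotient insert_commute)

text \<open>Two shared points put two of the columns and their sum among the base vectors, which
  leaves few cases.\<close>

lemma card_Int_base_superbasis_iff:
  assumes "X \<in> carrier PGL2Z"
  shows "card (phi X \<inter> phi \<one>\<^bsub>PGL2Z\<^esub>) = 2 \<longleftrightarrow> phi X \<in> (\<lambda>k. phi (k \<otimes>\<^bsub>PGL2Z\<^esub> rho1)) ` stab"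
proof
  assume "phi X \<in> (\<lambda>k. phi (k \<otimes>\<^bsub>PGL2Z\<^esub> rho1)) ` stab"
  then show "card (phi X \<inter> phi \<one>\<^bsub>PGL2Z\<^esub>) = 2"
    unfolding phi_stab_rho1 one_PGL2 phi_proj base_superbasis by (elim insertE emptyE) simp_all
next
  assume card: "card (phi X \<inter> phi \<one>\<^bsub>PGL2Z\<^esub>) = 2"
  obtain a b c d where X: "X = proj (mat2 a b c d)" and inv: "invertible (mat2 a b c d :: int^2^2)"
    using assms by (metis PGL2Z_cases mat2_cases)
  let ?T = "insert {Infinity, Finite_Point 0, Finite_Point 1}
    {{Infinity, Finite_Point 0, Finite_Point (-1)}, {Infinity, Finite_Point 1, Finite_Point 2},
     {Finite_Point 0, Finite_Point 1, Finite_Point (1 / 2)}}"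
  have "(a, c) \<in> base_vectors \<and> (b, d) \<in> base_vectors \<or>
    (a, c) \<in> base_vectors \<and> (a + b, c + d) \<in> base_vectors \<or>
    (b, d) \<in> base_vectors \<and> (a + b, c + d) \<in> base_vectors"
    using two_of_three[OF card[unfolded X one_PGL2 phi_proj superbasis_of_matrix_mat2]]
      columns_in_base_superbasis[OF inv] by blast
  then have "phi X \<in> insert (phi \<one>\<^bsub>PGL2Z\<^esub>) ((\<lambda>k. phi (k \<otimes>\<^bsub>PGL2Z\<^esub> rho1)) ` stab)"
    unfolding phi_stab_rho1 one_PGL2 phi_proj base_superbasis X superbasis_of_matrix_mat2
    proof (elim disjE conjE)
    assume "(a, c) \<in> base_vectors" "(b, d) \<in> base_vectors"
    then show "{point (vector [a, c]), point (vector [b, d]), point (vector [a + b, c + d])} \<in> ?T"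
      using inv unfolding base_vectors_def
      by (elim insertE emptyE) (simp_all add: point_def Fract_of_int_quotient set_eq_subset)
  next
    \<comment> \<open>With the column sum as variable, both memberships assign values to variables
      and the other column is computed.\<close>
    define b' d' where "b' = a + b" "d' = c + d"
    then have bd: "b = b' - a" "d = d' - c" by simp_all
    assume "(a, c) \<in> base_vectors" "(a + b, c + d) \<in> base_vectors"
    then show "{point (vector [a, c]), point (vector [b, d]), point (vector [a + b, c + d])} \<in> ?T"
      using inv unfolding bd base_vectors_def
      by (elim insertE emptyE) (simp_all add: point_def Fract_of_int_quotient set_eq_subset)
  next
    define a' c' where "a' = a + b" "c' = c + d"
    then have ac: "a = a' - b" "c = c' - d" by simp_all
    assume "(b, d) \<in> base_vectors" "(a + b, c + d) \<in> base_vectors"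
    then show "{point (vector [a, c]), point (vector [b, d]), point (vector [a + b, c + d])} \<in> ?T"
      using inv unfolding ac base_vectors_def
      by (elim insertE emptyE) (simp_all add: point_def Fract_of_int_quotient set_eq_subset)
  qed
  moreover have "phi X \<noteq> phi \<one>\<^bsub>PGL2Z\<^esub>"
    using card by (auto simp: one_PGL2 base_superbasis)
  ultimately show "phi X \<in> (\<lambda>k. phi (k \<otimes>\<^bsub>PGL2Z\<^esub> rho1)) ` stab"
    by blast
qed

text \<open>The Euclidean algorithm by column operations. It is stated for a set \<open>L\<close>
  closed under right multiplication so that it applies to products of a subgroup with
  \<open>stab\<close>.\<close>

lemma carrier_PGL2Z_subset:
  assumes one: "\<one>\<^bsub>PGL2Z\<^esub> \<in> L"
    and stab: "\<And>X k. X \<in> L \<Longrightarrow> X \<in> carrier PGL2Z \<Longrightarrow> k \<in> stab \<Longrightarrow> X \<otimes>\<^bsub>PGL2Z\<^esub> k \<in> L"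
    and rho1: "\<And>X. X \<in> L \<Longrightarrow> X \<in> carrier PGL2Z \<Longrightarrow> X \<otimes>\<^bsub>PGL2Z\<^esub> rho1 \<in> L"
  shows "carrier PGL2Z \<subseteq> L"
proof -
  define P where "P a b c d \<longleftrightarrow> proj (mat2 a b c d) \<in> L" for a b c d
  define U where "U a b c d \<longleftrightarrow> invertible (mat2 a b c d :: int^2^2)" for a b c d
  have stab': "proj (A ** B) \<in> L" if "proj A \<in> L" "invertible A" "B \<in> stab_mats" for A B
    using stab[of "proj A" "proj B"] that by (auto simp: stab_def stab_mats_def)
  have rho1': "proj (A ** mat2 (-1) 0 0 1) \<in> L" if "proj A \<in> L" "invertible A" for A
    using rho1[of "proj A"] that by (auto simp: rho1_def)
  have minus: "proj (- A) = proj A" for A :: "int^2^2" by simp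
  have swap: "P a b c d" if "P b a d c" "U b a d c" for a b c d
    using stab'[of "mat2 b a d c" "mat2 0 1 1 0"] that
    by (simp add: P_def U_def stab_mats_def del: invertible_mat2_int)
  have neg: "P (- a) b (- c) d" if "P a b c d" "U a b c d" for a b c d
    using rho1'[of "mat2 a b c d"] that by (simp add: P_def U_def del: invertible_mat2_int)
  have add: "P a (a + b) c (c + d)" if "P a b c d" "U a b c d" for a b c d
  proof -
    \<comment> \<open>This element of \<open>stab\<close> turns the second column into minus the
      column sum; \<open>neg\<close> and the sign ambiguity then give the sum.\<close>
    have "P a (- (a + b)) c (- (c + d))" "U a (- (a + b)) c (- (c + d))"
      using stab'[of "mat2 a b c d" "mat2 1 (-1) 0 (-1)"] that
      by (auto simp: P_def U_def stab_mats_def algebra_simps)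
    from neg[OF this] show ?thesis
      using minus[of "mat2 a (a + b) c (c + d)"]
      by (simp add: P_def del: proj_int_eq_iff)
  qed
  \<comment> \<open>Subtraction is addition conjugated by the negation of the first column.\<close>
  have sub: "P a (b - a) c (d - c)" if "P a b c d" "U a b c d" for a b c d
  proof -
    have U: "U (- a) b (- c) d" "U (- a) (- a + b) (- c) (- c + d)"
      using that by (auto simp: U_def algebra_simps)
    show ?thesis
      using neg[OF add[OF neg[OF that] U(1)] U(2)] by simp
  qed
  have diag: "P a 0 0 d" if "U a 0 0 d" for a d
  proof -
    have "P 1 0 0 1" "P (-1) 0 0 1"
      using one neg[of 1 0 0 1] by (simp_all add: P_def U_def one_PGL2 mat_eq_mat2)
    moreover from this have "P (-1) 0 0 (-1)" "P 1 0 0 (-1)"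
      using minus[of "mat2 1 0 0 1"] minus[of "mat2 (-1) 0 0 1"]
      by (simp_all add: P_def del: proj_int_eq_iff)
    moreover have "a * d dvd 1"
      using that by (auto simp: U_def)
    then have "\<bar>a\<bar> = 1" "\<bar>d\<bar> = 1"
      by (metis is_unit_mult_iff zdvd1_eq)+
    ultimately show ?thesis by (auto simp: abs_if split: if_splits)
  qed
  \<comment> \<open>Since \<open>a\<close> is \<plusminus>1, adding or subtracting the first column
    shortens a nonzero \<open>b\<close>.\<close>
  have triangular: "P a b 0 d" if "U a b 0 d" for a b d
    using that
  proof (induction "nat \<bar>b\<bar>" arbitrary: b rule: less_induct)
    case less
    have U: "U a (b - a) 0 d" "U a (b + a) 0 d"
      using less.prems by (auto simp: U_def)
    have "a * d dvd 1"
      using less.prems by (auto simp: U_def)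
    then have "\<bar>a\<bar> = 1"
      by (metis is_unit_mult_iff zdvd1_eq)
    then consider "b = 0" | "\<bar>b - a\<bar> < \<bar>b\<bar>" | "\<bar>b + a\<bar> < \<bar>b\<bar>"
      by linarith
    then show ?case
    proof cases
      case 1
      then show ?thesis using diag less.prems by simp
    next
      case 2
      then have "P a (b - a) 0 d" using less.hyps U by simp
      from add[OF this U(1)] show ?thesis by simp
    next
      case 3
      then have "P a (b + a) 0 d" using less.hyps U by simp
      from sub[OF this U(2)] show ?thesis by simp
    qed
  qed
  \<comment> \<open>Euclid on the bottom row, until one of its entries vanishes.\<close>
  have "P a b c d" if "U a b c d" for a b c d
    using that
  proof (induction "nat (\<bar>c\<bar> + \<bar>d\<bar>)" arbitrary: a b c d rule: less_induct)
    case less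
    \<comment> \<open>The variables are fresh and the induction hypothesis is an assumption, so the
      step also serves the matrix with swapped columns.\<close>
    have reduce: "P a b c d" if le: "c \<noteq> 0" "\<bar>c\<bar> \<le> \<bar>d\<bar>" "U a b c d"
      and IH: "\<And>a' b' c' d'. \<bar>c'\<bar> + \<bar>d'\<bar> < \<bar>c\<bar> + \<bar>d\<bar> \<Longrightarrow> U a' b' c' d' \<Longrightarrow> P a' b' c' d'" for a b c d
    proof -
      have U: "U a (b - a) c (d - c)" "U a (b + a) c (d + c)"
        using that by (auto simp: U_def algebra_simps)
      consider "\<bar>d - c\<bar> < \<bar>d\<bar>" | "\<bar>d + c\<bar> < \<bar>d\<bar>"
        using le by linarith
      then show ?thesis
      proof cases
        case 1
        then have "P a (b - a) c (d - c)" using IH U by simp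
        from add[OF this U(1)] show ?thesis by simp
      next
        case 2
        then have "P a (b + a) c (d + c)" using IH U by simp
        from sub[OF this U(2)] show ?thesis by simp
      qed
    qed
    have U: "U b a d c"
      using less.prems by (auto simp: U_def algebra_simps)
    consider "c = 0" | "d = 0" | "c \<noteq> 0" "\<bar>c\<bar> \<le> \<bar>d\<bar>" | "d \<noteq> 0" "\<bar>d\<bar> \<le> \<bar>c\<bar>"
      by linarith
    then show ?case
    proof cases
      case 1
      then show ?thesis using triangular less.prems by simp
    next
      case 2
      then show ?thesis using triangular U swap by simp
    next
      case 3
      then show ?thesis using reduce less by simp
    next
      case 4
      have "P b a d c"
        by (rule reduce[OF 4 U], rule less.hyps) auto
      then show ?thesis using U by (rule swap)
    qed
  qed
  then show ?thesis
    by (metis P_def U_def PGL2Z_cases mat2_cases subsetI)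
qed

section \<open>Topographical groups as complements of the stabilizer\<close>

text \<open>Dedekind's modular law: if h = nk, then k = n^{-1}h lies in both \<open>H\<close> and
  \<open>K\<close>, so it is trivial.\<close>

lemma (in group) subgroup_eq_of_set_mult:
  assumes "subgroup N G" "subgroup H G" "K \<subseteq> carrier G" "N \<subseteq> H" "H \<inter> K \<subseteq> {\<one>}" "H \<subseteq> N <#> K"
  shows "N = H"
proof
  show "H \<subseteq> N"
  proof
    fix h assume h: "h \<in> H"
    then obtain n k where nk: "n \<in> N" "k \<in> K" "h = n \<otimes> k"
      using assms(6) unfolding set_mult_def by blast
    then have "n \<in> carrier G" "k \<in> carrier G" "n \<in> H"
      using nk(1,2) assms(3,4) subgroup.mem_carrier[OF assms(1)] by auto
    then have "k = inv n \<otimes> h"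
      using nk(3) inv_solve_left' by (simp add: m_assoc[symmetric])
    then have "k \<in> H"
      using h \<open>n \<in> H\<close> assms(2) by (simp add: subgroup.m_closed subgroup.m_inv_closed)
    then have "k = \<one>"
      using nk(2) assms(5) by blast
    then show "h \<in> N"
      using nk \<open>n \<in> carrier G\<close> by simp
  qed
qed (rule assms(4))

section \<open>Left translations as symmetries of the topograph\<close>

lemma phi_mult: "invertible A \<Longrightarrow> X \<in> carrier PGL2Z \<Longrightarrow> phi (proj A \<otimes>\<^bsub>PGL2Z\<^esub> X) = act A ` phi X"
  by (elim PGL2Z_cases) (simp add: superbasis_of_matrix_mult)

lemma phi_mult_eq_iff:
  assumes "X \<in> carrier PGL2Z" "Y \<in> carrier PGL2Z" "Z \<in> carrier PGL2Z"
  shows "phi (X \<otimes>\<^bsub>PGL2Z\<^esub> Y) = phi (X \<otimes>\<^bsub>PGL2Z\<^esub> Z) \<longleftrightarrow> phi Y = phi Z"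
  using assms by (metis PGL2Z_cases phi_mult inj_act inj_image_eq_iff)

lemma card_phi_Int_mult:
  assumes "X \<in> carrier PGL2Z" "Y \<in> carrier PGL2Z" "Z \<in> carrier PGL2Z"
  shows "card (phi (X \<otimes>\<^bsub>PGL2Z\<^esub> Y) \<inter> phi (X \<otimes>\<^bsub>PGL2Z\<^esub> Z)) = card (phi Y \<inter> phi Z)"
proof -
  obtain A where A: "invertible A" "X = proj A"
    using assms(1) by (rule PGL2Z_cases)
  then have "phi (X \<otimes>\<^bsub>PGL2Z\<^esub> Y) \<inter> phi (X \<otimes>\<^bsub>PGL2Z\<^esub> Z) = act A ` (phi Y \<inter> phi Z)"
    using assms by (simp add: phi_mult image_Int inj_act)
  then show ?thesis
    using A(1) by (metis card_image inj_act inj_on_subset subset_UNIV)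
qed

lemma phi_mult_stab:
  assumes "X \<in> carrier PGL2Z" "k \<in> stab"
  shows "phi (X \<otimes>\<^bsub>PGL2Z\<^esub> k) = phi X"
  using assms phi_mult_eq_iff[of X k "\<one>\<^bsub>PGL2Z\<^esub>"] mem_stab_iff stab_subset by force

text \<open>Follows from the fibre description \<open>mem_stab_iff\<close> and
  \<open>phi_mult_stab\<close>, without multiplying the six matrices.\<close>

lemma subgroup_stab: "subgroup stab PGL2Z"
proof (rule PGL2Z.subgroupI)
  show "stab \<noteq> {}" by (auto simp: stab_def stab_mats_def)
next
  fix k assume k: "k \<in> stab"
  then have "k \<in> carrier PGL2Z" using stab_subset by blast
  then show "inv\<^bsub>PGL2Z\<^esub> k \<in> stab"
    using k phi_mult_stab[of "inv\<^bsub>PGL2Z\<^esub> k" k] by (simp add: mem_stab_iff)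
next
  fix k l assume kl: "k \<in> stab" "l \<in> stab"
  then have "k \<in> carrier PGL2Z" "l \<in> carrier PGL2Z" using stab_subset by blast+
  then show "k \<otimes>\<^bsub>PGL2Z\<^esub> l \<in> stab"
    using kl phi_mult_stab[of k l] by (simp add: mem_stab_iff)
qed (rule stab_subset)

text \<open>Left translation moves the comparison to the base superbasis: the fibres of
  \<open>phi\<close> are left cosets of \<open>stab\<close>.\<close>

lemma phi_eq_iff:
  assumes "X \<in> carrier PGL2Z" "Y \<in> carrier PGL2Z"
  shows "phi X = phi Y \<longleftrightarrow> inv\<^bsub>PGL2Z\<^esub> X \<otimes>\<^bsub>PGL2Z\<^esub> Y \<in> stab"
  using assms phi_mult_eq_iff[of "inv\<^bsub>PGL2Z\<^esub> X" X Y] by (auto simp: mem_stab_iff)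

lemma superbasis_iff_phi: "superbasis T \<longleftrightarrow> T \<in> phi ` carrier PGL2Z"
  by (auto simp: superbasis_iff carrier_PGL2 image_image)

lemma rho1_carrier: "rho1 \<in> carrier PGL2Z"
  by (simp add: rho1_def)

text \<open>On \<open>H\<close>, \<open>phi\<close> is injective when \<open>H\<close> meets
  \<open>stab\<close> trivially and surjective when the two multiply to the whole group. Edges then
  match by translation to the base superbasis.\<close>

lemma topographical_iff:
  "topographical H \<longleftrightarrow> subgroup H PGL2Z \<and> H \<inter> stab = {\<one>\<^bsub>PGL2Z\<^esub>} \<and> H <#>\<^bsub>PGL2Z\<^esub> stab = carrier PGL2Z"
    (is "_ \<longleftrightarrow> ?complement")
proof
  assume "topographical H"
  then have H: "subgroup H PGL2Z" and bij: "bij_betw phi H {T. superbasis T}"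
    by (auto simp: topographical_def graph_iso_def cayley_graph_def topograph_def)
  have "k = \<one>\<^bsub>PGL2Z\<^esub>" if "k \<in> H" "k \<in> stab" for k
    using that bij_betw_imp_inj_on[OF bij] subgroup.one_closed[OF H] mem_stab_iff stab_subset
    by (metis inj_on_eq_iff subsetD)
  moreover have "X \<in> H <#>\<^bsub>PGL2Z\<^esub> stab" if X: "X \<in> carrier PGL2Z" for X
  proof -
    have "phi X \<in> phi ` H"
      using bij_betw_imp_surj_on[OF bij] X superbasis_iff_phi by auto
    then obtain h where h: "h \<in> H" "phi h = phi X" by auto
    then have "h \<in> carrier PGL2Z" using subgroup.mem_carrier[OF H] by blast
    then have "inv\<^bsub>PGL2Z\<^esub> h \<otimes>\<^bsub>PGL2Z\<^esub> X \<in> stab" "X = h \<otimes>\<^bsub>PGL2Z\<^esub> (inv\<^bsub>PGL2Z\<^esub> h \<otimes>\<^bsub>PGL2Z\<^esub> X)"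
      using X h(2) phi_eq_iff PGL2Z.m_assoc[of h "inv\<^bsub>PGL2Z\<^esub> h" X] by simp_all
    then show ?thesis
      using h(1) unfolding set_mult_def by blast
  qed
  ultimately show ?complement
    using H subgroup.one_closed[OF H] subgroup.one_closed[OF subgroup_stab]
      PGL2Z.set_mult_closed[OF subgroup.subset[OF H] stab_subset] by blast
next
  assume ?complement
  then have H: "subgroup H PGL2Z" and Int: "H \<inter> stab = {\<one>\<^bsub>PGL2Z\<^esub>}"
    and HK: "carrier PGL2Z \<subseteq> H <#>\<^bsub>PGL2Z\<^esub> stab" by auto
  note in_carrier [simp] = subgroup.mem_carrier[OF H] subsetD[OF stab_subset] rho1_carrier
  have decomp: "\<exists>h\<in>H. \<exists>k\<in>stab. X = h \<otimes>\<^bsub>PGL2Z\<^esub> k" if "X \<in> carrier PGL2Z" for X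
    using HK that unfolding set_mult_def by blast
  have "inj_on phi H"
  proof (rule inj_onI)
    fix x y assume xy: "x \<in> H" "y \<in> H" "phi x = phi y"
    then have "inv\<^bsub>PGL2Z\<^esub> x \<otimes>\<^bsub>PGL2Z\<^esub> y \<in> H \<inter> stab"
      using phi_eq_iff[of x y] by (simp add: subgroup.m_closed[OF H] subgroup.m_inv_closed[OF H])
    then have "inv\<^bsub>PGL2Z\<^esub> x \<otimes>\<^bsub>PGL2Z\<^esub> y = \<one>\<^bsub>PGL2Z\<^esub>"
      using Int by blast
    then show "x = y"
      using xy by (metis PGL2Z.inv_closed PGL2Z.inv_equality PGL2Z.inv_inv in_carrier(1))
  qed
  moreover have surj: "\<exists>h\<in>H. phi h = T" if "superbasis T" for T
    using that decomp phi_mult_stab unfolding superbasis_iff_phi by fastforce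
  ultimately have bij: "bij_betw phi H {T. superbasis T}"
    unfolding bij_betw_def using superbasis_iff_phi in_carrier(1) by blast
  \<comment> \<open>All elements of \<open>H\<close> over neighbours of the base superbasis; left
    translation spreads them to every edge.\<close>
  define S where "S = {s \<in> H. card (phi s \<inter> phi \<one>\<^bsub>PGL2Z\<^esub>) = 2}"
  have SH: "S \<subseteq> H" by (auto simp: S_def)
  then have gen_H: "generate PGL2Z S \<subseteq> H"
    using PGL2Z.generate_subgroup_incl H by blast
  have gen: "subgroup (generate PGL2Z S) PGL2Z"
    by (rule PGL2Z.generate_is_subgroup) (use SH in auto)
  \<comment> \<open>Connectedness of the topograph enters here: a product absorbing
    \<open>stab\<close> and \<open>rho1\<close> on the right is everything.\<close>
  have "carrier PGL2Z \<subseteq> generate PGL2Z S <#>\<^bsub>PGL2Z\<^esub> stab"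
  proof (rule carrier_PGL2Z_subset)
    show "\<one>\<^bsub>PGL2Z\<^esub> \<in> generate PGL2Z S <#>\<^bsub>PGL2Z\<^esub> stab"
      using subgroup.one_closed[OF gen] subgroup.one_closed[OF subgroup_stab]
      unfolding set_mult_def by force
  next
    fix X l assume "X \<in> generate PGL2Z S <#>\<^bsub>PGL2Z\<^esub> stab" and l: "l \<in> stab"
    then obtain g k where "g \<in> generate PGL2Z S" "k \<in> stab" "X = g \<otimes>\<^bsub>PGL2Z\<^esub> k"
      unfolding set_mult_def by blast
    moreover from this have "X \<otimes>\<^bsub>PGL2Z\<^esub> l = g \<otimes>\<^bsub>PGL2Z\<^esub> (k \<otimes>\<^bsub>PGL2Z\<^esub> l)"
      using l gen_H by (simp add: PGL2Z.m_assoc subsetD)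
    ultimately show "X \<otimes>\<^bsub>PGL2Z\<^esub> l \<in> generate PGL2Z S <#>\<^bsub>PGL2Z\<^esub> stab"
      using subgroup.m_closed[OF subgroup_stab] l unfolding set_mult_def by blast
  next
    fix X assume "X \<in> generate PGL2Z S <#>\<^bsub>PGL2Z\<^esub> stab"
    then obtain g k where gk: "g \<in> generate PGL2Z S" "k \<in> stab" "X = g \<otimes>\<^bsub>PGL2Z\<^esub> k"
      unfolding set_mult_def by blast
    \<comment> \<open>The product of \<open>k\<close> and \<open>rho1\<close> lies over a neighbour
      of the base superbasis, so its component \<open>h\<close> belongs to \<open>S\<close>.\<close>
    obtain h l where hl: "h \<in> H" "l \<in> stab" "k \<otimes>\<^bsub>PGL2Z\<^esub> rho1 = h \<otimes>\<^bsub>PGL2Z\<^esub> l"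
      using decomp[of "k \<otimes>\<^bsub>PGL2Z\<^esub> rho1"] gk by auto
    then have "phi h = phi (k \<otimes>\<^bsub>PGL2Z\<^esub> rho1)"
      using phi_mult_stab by simp
    then have "phi h \<in> (\<lambda>k. phi (k \<otimes>\<^bsub>PGL2Z\<^esub> rho1)) ` stab"
      using gk(2) by (rule image_eqI)
    then have "h \<in> S"
      unfolding S_def using hl(1) card_Int_base_superbasis_iff[OF in_carrier(1)[OF hl(1)]] by blast
    then have "g \<otimes>\<^bsub>PGL2Z\<^esub> h \<in> generate PGL2Z S"
      using gk by (blast intro: generate.eng generate.incl)
    moreover have "X \<otimes>\<^bsub>PGL2Z\<^esub> rho1 = g \<otimes>\<^bsub>PGL2Z\<^esub> h \<otimes>\<^bsub>PGL2Z\<^esub> l"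
      using gk hl gen_H by (simp add: PGL2Z.m_assoc subsetD)
    ultimately show "X \<otimes>\<^bsub>PGL2Z\<^esub> rho1 \<in> generate PGL2Z S <#>\<^bsub>PGL2Z\<^esub> stab"
      using hl(2) unfolding set_mult_def by blast
  qed
  then have "generate PGL2Z S = H"
    using PGL2Z.subgroup_eq_of_set_mult[OF gen H stab_subset gen_H] Int subgroup.subset[OF H] by blast
  moreover have "(\<lambda>e. phi ` e) ` snd (cayley_graph PGL2Z H S) = snd topograph"
  proof -
    \<comment> \<open>Translation by \<open>h\<close> preserves the number of shared points, so
      adjacency is checked at the identity.\<close>
    have 1: "phi ` {h, h \<otimes>\<^bsub>PGL2Z\<^esub> s} \<in> snd topograph" if "h \<in> H" "s \<in> S" for h s
    proof -
      have s: "s \<in> carrier PGL2Z" using that(2) SH by auto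
      have "card (phi (h \<otimes>\<^bsub>PGL2Z\<^esub> \<one>\<^bsub>PGL2Z\<^esub>) \<inter> phi (h \<otimes>\<^bsub>PGL2Z\<^esub> s)) = 2"
        using that s card_phi_Int_mult[of h "\<one>\<^bsub>PGL2Z\<^esub>" s] by (simp add: S_def Int_commute)
      then have "card (phi h \<inter> phi (h \<otimes>\<^bsub>PGL2Z\<^esub> s)) = 2"
        using that by simp
      moreover have "superbasis (phi h)" "superbasis (phi (h \<otimes>\<^bsub>PGL2Z\<^esub> s))"
        using that s by (simp_all add: superbasis_iff_phi)
      ultimately show ?thesis
        unfolding topograph_def snd_conv image_insert image_empty by blast
    qed
    have 2: "{T, U} \<in> (\<lambda>e. phi ` e) ` snd (cayley_graph PGL2Z H S)"
      if TU: "superbasis T" "superbasis U" "card (T \<inter> U) = 2" for T U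
    proof -
      obtain h h' where h: "h \<in> H" "h' \<in> H" "phi h = T" "phi h' = U"
        using surj TU by blast
      define s where "s = inv\<^bsub>PGL2Z\<^esub> h \<otimes>\<^bsub>PGL2Z\<^esub> h'"
      have "s \<in> H"
        using h by (simp add: s_def subgroup.m_closed[OF H] subgroup.m_inv_closed[OF H])
      moreover have hs: "h \<otimes>\<^bsub>PGL2Z\<^esub> s = h'"
        using h PGL2Z.m_assoc[of h "inv\<^bsub>PGL2Z\<^esub> h" h'] by (simp add: s_def)
      moreover have "card (phi s \<inter> phi \<one>\<^bsub>PGL2Z\<^esub>) = 2"
        using \<open>s \<in> H\<close> h hs TU(3) card_phi_Int_mult[of h s "\<one>\<^bsub>PGL2Z\<^esub>"] by (simp add: Int_commute)
      ultimately have "{h, h'} \<in> snd (cayley_graph PGL2Z H S)"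
        using h by (auto simp: cayley_graph_def S_def)
      then show ?thesis
        by (rule rev_image_eqI) (simp add: h)
    qed
    have "phi ` e \<in> snd topograph" if e: "e \<in> snd (cayley_graph PGL2Z H S)" for e
    proof -
      obtain h s where "h \<in> H" "s \<in> S" "e = {h, h \<otimes>\<^bsub>PGL2Z\<^esub> s}"
        using e unfolding cayley_graph_def by auto
      then show ?thesis using 1 by simp
    qed
    moreover have "e \<in> (\<lambda>e. phi ` e) ` snd (cayley_graph PGL2Z H S)" if e: "e \<in> snd topograph" for e
    proof -
      obtain T U where "superbasis T" "superbasis U" "card (T \<inter> U) = 2" "e = {T, U}"
        using e unfolding topograph_def by auto
      then show ?thesis using 2 by simp
    qed
    ultimately show ?thesis by blast
  qed
  ultimately show "topographical H"
    using H SH bij unfolding topographical_def graph_iso_def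
    by (intro conjI exI[of _ S]) (simp_all add: cayley_graph_def topograph_def)
qed

section \<open>Normal complements\<close>

lemma (in group) inv_mult_cancel: "x \<in> carrier G \<Longrightarrow> y \<in> carrier G \<Longrightarrow> inv x \<otimes> (x \<otimes> y) = y"
  by (simp add: m_assoc[symmetric])

lemma (in group) mult_inv_cancel: "x \<in> carrier G \<Longrightarrow> y \<in> carrier G \<Longrightarrow> x \<otimes> (inv x \<otimes> y) = y"
  by (simp add: m_assoc[symmetric])

lemma inv_proj:
  assumes "invertible A" "invertible B" "B ** A = mat 1"
  shows "inv\<^bsub>PGL2\<^esub> (proj A) = proj B"
  by (rule group.inv_equality[OF group_PGL2]) (use assms in \<open>simp_all add: one_PGL2\<close>)

lemma generators_carrier:
  "rho2 \<in> carrier PGL2Z" "rho3 \<in> carrier PGL2Z"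
  "gamma1 \<in> carrier PGL2Z" "gamma2 \<in> carrier PGL2Z" "gamma3 \<in> carrier PGL2Z"
  by (simp_all add: rho2_def rho3_def gamma1_def gamma2_def gamma3_def)

text \<open>The reflection fixing the edge \<open>{0, 1}\<close> of the base superbasis is the conjugate of \<open>rho3\<close> by
  \<open>rho1\<close>, not \<open>rho3\<close> itself.\<close>

lemma stab_conj_rho1:
  "k \<in> stab \<Longrightarrow> \<exists>r\<in>{rho1, rho2, rho1 \<otimes>\<^bsub>PGL2Z\<^esub> rho3 \<otimes>\<^bsub>PGL2Z\<^esub> rho1}.
    k \<otimes>\<^bsub>PGL2Z\<^esub> rho1 = r \<otimes>\<^bsub>PGL2Z\<^esub> k"
  unfolding stab_def stab_mats_def image_insert image_empty
  by (elim insertE emptyE) (simp_all add: rho1_def rho2_def rho3_def)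

text \<open>The three involutions exchange \<infinity> with 1, 0 with 1 and \<infinity> with 0;
  \<open>stab\<close> permutes these pairs.\<close>

lemma stab_conj_gamma3:
  "k \<in> stab \<Longrightarrow> \<exists>r\<in>{gamma1, gamma2, gamma3}. k \<otimes>\<^bsub>PGL2Z\<^esub> gamma3 = r \<otimes>\<^bsub>PGL2Z\<^esub> k"
  unfolding stab_def stab_mats_def image_insert image_empty
  by (elim insertE emptyE) (simp_all add: gamma1_def gamma2_def gamma3_def)

lemma rho_conj:
  assumes "r \<in> {rho1, rho2, rho3}"
  shows "\<exists>k\<in>carrier PGL2Z. k \<otimes>\<^bsub>PGL2Z\<^esub> rho1 = r \<otimes>\<^bsub>PGL2Z\<^esub> k"
proof -
  have "proj A \<in> carrier PGL2Z" "proj A \<otimes>\<^bsub>PGL2Z\<^esub> rho1 = r \<otimes>\<^bsub>PGL2Z\<^esub> proj A"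
    \<comment> \<open>The conjugator for \<open>rho3\<close> stabilizes the neighbour {\<infinity>,
      0, -1} and is not in \<open>stab\<close>.\<close>
    if "r = rho1 \<and> A = mat2 1 0 0 1 \<or> r = rho2 \<and> A = mat2 (-1) 1 (-1) 0 \<or> r = rho3 \<and> A = mat2 0 1 1 (-1)"
    for A
    using that by (elim disjE; simp add: rho1_def rho2_def rho3_def)+
  then show ?thesis using assms by blast
qed

lemma gamma_conj: "r \<in> {gamma1, gamma2, gamma3} \<Longrightarrow> \<exists>k\<in>stab. k \<otimes>\<^bsub>PGL2Z\<^esub> gamma3 = r \<otimes>\<^bsub>PGL2Z\<^esub> k"
  unfolding stab_def stab_mats_def image_insert image_empty
  by (elim insertE emptyE) (simp_all add: gamma1_def gamma2_def gamma3_def)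

text \<open>Since \<open>rho1\<close> is \<open>t\<close> times \<open>s\<close>, moving
  \<open>s\<close> to the left past \<open>k\<close> and \<open>t\<close> shows that the product
  absorbs \<open>rho1\<close>. The factor \<open>t\<close> treats \<open>s = rho1\<close> (with
  \<open>t\<close> trivial) and \<open>s = gamma3\<close> (with \<open>t\<close> the exchange)
  together.\<close>

lemma set_mult_stab_eq_carrier:
  assumes N: "subgroup N PGL2Z" and s: "s \<in> carrier PGL2Z"
    and t: "t \<in> stab" "t \<otimes>\<^bsub>PGL2Z\<^esub> s = rho1"
    and conj: "\<And>k. k \<in> stab \<Longrightarrow> \<exists>r\<in>N. k \<otimes>\<^bsub>PGL2Z\<^esub> s = r \<otimes>\<^bsub>PGL2Z\<^esub> k"
  shows "N <#>\<^bsub>PGL2Z\<^esub> stab = carrier PGL2Z"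
proof
  note in_carrier [simp] = subgroup.mem_carrier[OF N] subsetD[OF stab_subset] s
  show "N <#>\<^bsub>PGL2Z\<^esub> stab \<subseteq> carrier PGL2Z"
    by (rule PGL2Z.set_mult_closed[OF subgroup.subset[OF N] stab_subset])
  show "carrier PGL2Z \<subseteq> N <#>\<^bsub>PGL2Z\<^esub> stab"
  proof (rule carrier_PGL2Z_subset)
    show "\<one>\<^bsub>PGL2Z\<^esub> \<in> N <#>\<^bsub>PGL2Z\<^esub> stab"
      using subgroup.one_closed[OF N] subgroup.one_closed[OF subgroup_stab]
      unfolding set_mult_def by force
  next
    fix X l assume "X \<in> N <#>\<^bsub>PGL2Z\<^esub> stab" and l: "l \<in> stab"
    then obtain g k where gk: "g \<in> N" "k \<in> stab" "X = g \<otimes>\<^bsub>PGL2Z\<^esub> k"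
      unfolding set_mult_def by blast
    then have "X \<otimes>\<^bsub>PGL2Z\<^esub> l = g \<otimes>\<^bsub>PGL2Z\<^esub> (k \<otimes>\<^bsub>PGL2Z\<^esub> l)"
      using l by (simp add: PGL2Z.m_assoc)
    then show "X \<otimes>\<^bsub>PGL2Z\<^esub> l \<in> N <#>\<^bsub>PGL2Z\<^esub> stab"
      using gk subgroup.m_closed[OF subgroup_stab] l unfolding set_mult_def by blast
  next
    fix X assume "X \<in> N <#>\<^bsub>PGL2Z\<^esub> stab"
    then obtain g k where gk: "g \<in> N" "k \<in> stab" "X = g \<otimes>\<^bsub>PGL2Z\<^esub> k"
      unfolding set_mult_def by blast
    have kt: "k \<otimes>\<^bsub>PGL2Z\<^esub> t \<in> stab"
      using gk t subgroup.m_closed[OF subgroup_stab] by blast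
    then obtain r where r: "r \<in> N" "k \<otimes>\<^bsub>PGL2Z\<^esub> t \<otimes>\<^bsub>PGL2Z\<^esub> s = r \<otimes>\<^bsub>PGL2Z\<^esub> (k \<otimes>\<^bsub>PGL2Z\<^esub> t)"
      using conj by blast
    have "X \<otimes>\<^bsub>PGL2Z\<^esub> rho1 = g \<otimes>\<^bsub>PGL2Z\<^esub> (k \<otimes>\<^bsub>PGL2Z\<^esub> t \<otimes>\<^bsub>PGL2Z\<^esub> s)"
      using gk t(1) by (simp add: t(2)[symmetric] PGL2Z.m_assoc)
    also have "\<dots> = (g \<otimes>\<^bsub>PGL2Z\<^esub> r) \<otimes>\<^bsub>PGL2Z\<^esub> (k \<otimes>\<^bsub>PGL2Z\<^esub> t)"
      unfolding r(2) using gk r kt by (simp add: PGL2Z.m_assoc)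
    finally show "X \<otimes>\<^bsub>PGL2Z\<^esub> rho1 \<in> N <#>\<^bsub>PGL2Z\<^esub> stab"
      using kt subgroup.m_closed[OF N gk(1) r(1)] unfolding set_mult_def by blast
  qed
qed

lemma one_in_stab: "\<one>\<^bsub>PGL2Z\<^esub> \<in> stab"
  by (rule subgroup.one_closed[OF subgroup_stab])

lemma generate_rho_set_mult_stab:
  "generate PGL2Z {rho1, rho2, rho3} <#>\<^bsub>PGL2Z\<^esub> stab = carrier PGL2Z"
proof (rule set_mult_stab_eq_carrier)
  show "subgroup (generate PGL2Z {rho1, rho2, rho3}) PGL2Z"
    by (rule PGL2Z.generate_is_subgroup) (simp add: rho1_carrier generators_carrier)
  show "\<exists>r\<in>generate PGL2Z {rho1, rho2, rho3}. k \<otimes>\<^bsub>PGL2Z\<^esub> rho1 = r \<otimes>\<^bsub>PGL2Z\<^esub> k" if "k \<in> stab" for k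
  proof -
    have "rho1 \<in> generate PGL2Z {rho1, rho2, rho3}" "rho2 \<in> generate PGL2Z {rho1, rho2, rho3}"
      "rho3 \<in> generate PGL2Z {rho1, rho2, rho3}"
      by (simp_all add: generate.incl)
    then show ?thesis
      using stab_conj_rho1[OF that] by (blast intro: generate.eng)
  qed
  show "\<one>\<^bsub>PGL2Z\<^esub> \<otimes>\<^bsub>PGL2Z\<^esub> rho1 = rho1"
    by (rule PGL2Z.l_one[OF rho1_carrier])
qed (rule rho1_carrier one_in_stab)+

lemma generate_gamma_set_mult_stab:
  "generate PGL2Z {gamma1, gamma2, gamma3} <#>\<^bsub>PGL2Z\<^esub> stab = carrier PGL2Z"
proof (rule set_mult_stab_eq_carrier)
  show "subgroup (generate PGL2Z {gamma1, gamma2, gamma3}) PGL2Z"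
    by (rule PGL2Z.generate_is_subgroup) (simp add: generators_carrier)
  show "\<exists>r\<in>generate PGL2Z {gamma1, gamma2, gamma3}. k \<otimes>\<^bsub>PGL2Z\<^esub> gamma3 = r \<otimes>\<^bsub>PGL2Z\<^esub> k"
    if "k \<in> stab" for k
    using stab_conj_gamma3[OF that] generate.incl by metis
  show "proj (mat2 0 1 1 0) \<in> stab" "proj (mat2 0 1 1 0) \<otimes>\<^bsub>PGL2Z\<^esub> gamma3 = rho1"
    by (simp_all add: stab_def stab_mats_def gamma3_def rho1_def)
qed (rule generators_carrier)

section \<open>Recognition of normal complements\<close>

lemma normal_conj_mem:
  assumes "H \<lhd> PGL2Z" "s \<in> H" "k \<in> carrier PGL2Z" "r \<in> carrier PGL2Z"
    "k \<otimes>\<^bsub>PGL2Z\<^esub> s = r \<otimes>\<^bsub>PGL2Z\<^esub> k"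
  shows "r \<in> H"
proof -
  have "r = k \<otimes>\<^bsub>PGL2Z\<^esub> s \<otimes>\<^bsub>PGL2Z\<^esub> inv\<^bsub>PGL2Z\<^esub> k"
    using assms(3-5) PGL2Z.m_assoc[of r k "inv\<^bsub>PGL2Z\<^esub> k"] by simp
  then show ?thesis
    using PGL2Z.normal_invE(2)[OF assms(1,3,2)] by simp
qed

text \<open>Nested complements coincide; this serves both to identify the two groups and to prove
  uniqueness.\<close>

lemma eq_generate_of_complement:
  assumes H: "subgroup H PGL2Z" "H \<inter> stab = {\<one>\<^bsub>PGL2Z\<^esub>}" and R: "R \<subseteq> H"
    and RK: "generate PGL2Z R <#>\<^bsub>PGL2Z\<^esub> stab = carrier PGL2Z"
  shows "H = generate PGL2Z R"
proof -
  have "subgroup (generate PGL2Z R) PGL2Z"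
    using R subgroup.subset[OF H(1)] by (intro PGL2Z.generate_is_subgroup) blast
  moreover have "generate PGL2Z R \<subseteq> H"
    by (rule PGL2Z.generate_subgroup_incl[OF R H(1)])
  ultimately have "generate PGL2Z R = H"
    by (rule PGL2Z.subgroup_eq_of_set_mult[OF _ H(1) stab_subset])
      (simp_all add: H(2) RK subgroup.subset[OF H(1)])
  then show ?thesis ..
qed

lemma normal_complement_stab:
  assumes H: "H \<lhd> PGL2Z" and Int: "H \<inter> stab = {\<one>\<^bsub>PGL2Z\<^esub>}"
    and HK: "H <#>\<^bsub>PGL2Z\<^esub> stab = carrier PGL2Z"
  shows "H = generate PGL2Z {rho1, rho2, rho3} \<or> H = generate PGL2Z {gamma1, gamma2, gamma3}"
proof -
  have sub: "subgroup H PGL2Z" by (rule normal_imp_subgroup[OF H])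
  define t where "t = proj (mat2 0 1 1 0 :: int^2^2)"
  have t: "t \<in> stab" "rho1 \<otimes>\<^bsub>PGL2Z\<^esub> t = t \<otimes>\<^bsub>PGL2Z\<^esub> rho1"
    by (simp_all add: t_def stab_def stab_mats_def rho1_def)
  obtain h k where hk: "h \<in> H" "k \<in> stab" "rho1 = h \<otimes>\<^bsub>PGL2Z\<^esub> k"
    using HK rho1_carrier unfolding set_mult_def by blast
  have [simp]: "t \<in> carrier PGL2Z" "h \<in> carrier PGL2Z" "k \<in> carrier PGL2Z"
    using t hk subgroup.mem_carrier[OF sub] stab_subset by auto
  note [simp] = rho1_carrier generators_carrier
  \<comment> \<open>\<open>t\<close> centralizes \<open>rho1\<close>, so the commutator of \<open>k\<close> and \<open>t\<close> equals that of \<open>inv h\<close> and \<open>t\<close>,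
    hence lies in \<open>H\<close>.\<close>
  define c where "c = k \<otimes>\<^bsub>PGL2Z\<^esub> t \<otimes>\<^bsub>PGL2Z\<^esub> inv\<^bsub>PGL2Z\<^esub> k \<otimes>\<^bsub>PGL2Z\<^esub> inv\<^bsub>PGL2Z\<^esub> t"
  have "c \<in> stab"
    using hk(2) t(1) by (simp add: c_def subgroup.m_closed[OF subgroup_stab] subgroup.m_inv_closed[OF subgroup_stab])
  then have [simp]: "c \<in> carrier PGL2Z" using stab_subset by blast
  \<comment> \<open>Replace \<open>h\<close> times \<open>k\<close> by \<open>rho1\<close>, then
    move \<open>t\<close> past it.\<close>
  have "h \<otimes>\<^bsub>PGL2Z\<^esub> c = rho1 \<otimes>\<^bsub>PGL2Z\<^esub> t \<otimes>\<^bsub>PGL2Z\<^esub> inv\<^bsub>PGL2Z\<^esub> k \<otimes>\<^bsub>PGL2Z\<^esub> inv\<^bsub>PGL2Z\<^esub> t"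
    by (simp add: hk(3) c_def PGL2Z.m_assoc)
  also have "\<dots> = t \<otimes>\<^bsub>PGL2Z\<^esub> h \<otimes>\<^bsub>PGL2Z\<^esub> inv\<^bsub>PGL2Z\<^esub> t"
    unfolding t(2) by (simp add: hk(3) PGL2Z.m_assoc PGL2Z.mult_inv_cancel)
  finally have "c = inv\<^bsub>PGL2Z\<^esub> h \<otimes>\<^bsub>PGL2Z\<^esub> (t \<otimes>\<^bsub>PGL2Z\<^esub> h \<otimes>\<^bsub>PGL2Z\<^esub> inv\<^bsub>PGL2Z\<^esub> t)"
    by (simp add: PGL2Z.inv_solve_left)
  then have "c \<in> H"
    using PGL2Z.normal_invE(2)[OF H _ hk(1), of t] hk(1)
    by (simp add: subgroup.m_closed[OF sub] subgroup.m_inv_closed[OF sub])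
  then have "c = \<one>\<^bsub>PGL2Z\<^esub>"
    using \<open>c \<in> stab\<close> Int by blast
  moreover have "c \<otimes>\<^bsub>PGL2Z\<^esub> (t \<otimes>\<^bsub>PGL2Z\<^esub> k) = k \<otimes>\<^bsub>PGL2Z\<^esub> t"
    by (simp add: c_def PGL2Z.m_assoc PGL2Z.inv_mult_cancel)
  ultimately have "t \<otimes>\<^bsub>PGL2Z\<^esub> k = k \<otimes>\<^bsub>PGL2Z\<^esub> t"
    by simp
  \<comment> \<open>A transposition in the dihedral group of order 6 commutes only with itself and
    the identity.\<close>
  then have "k = \<one>\<^bsub>PGL2Z\<^esub> \<or> k = t"
    using hk(2) by (auto simp: stab_def stab_mats_def t_def one_PGL2 mat_eq_mat2)
  moreover have "gamma3 \<otimes>\<^bsub>PGL2Z\<^esub> t = rho1"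
    by (simp add: gamma3_def t_def rho1_def)
  ultimately have "rho1 \<in> H \<or> gamma3 \<in> H"
    using hk(1,3) PGL2Z.right_cancel[of t gamma3 h] by auto
  then show ?thesis
  proof
    assume "rho1 \<in> H"
    have "r \<in> H" if r: "r \<in> {rho1, rho2, rho3}" for r
    proof -
      obtain k where "k \<in> carrier PGL2Z" "k \<otimes>\<^bsub>PGL2Z\<^esub> rho1 = r \<otimes>\<^bsub>PGL2Z\<^esub> k"
        using rho_conj[OF r] by blast
      then show ?thesis
        using r by (intro normal_conj_mem[OF H \<open>rho1 \<in> H\<close>]) auto
    qed
    then show ?thesis
      using eq_generate_of_complement[OF sub Int _ generate_rho_set_mult_stab] by blast
  next
    assume "gamma3 \<in> H"
    have "r \<in> H" if r: "r \<in> {gamma1, gamma2, gamma3}" for r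
    proof -
      obtain k where "k \<in> stab" "k \<otimes>\<^bsub>PGL2Z\<^esub> gamma3 = r \<otimes>\<^bsub>PGL2Z\<^esub> k"
        using gamma_conj[OF r] by blast
      then show ?thesis
        using r stab_subset by (intro normal_conj_mem[OF H \<open>gamma3 \<in> H\<close>]) auto
    qed
    then show ?thesis
      using eq_generate_of_complement[OF sub Int _ generate_gamma_set_mult_stab] by blast
  qed
qed


section \<open>Cubes and the congruence subgroup of level 2\<close>

text \<open>These matrices have square -1, so their classes are involutions and equal their own
  cubes.\<close>

lemma gammas_in_Gamma_cubes: "{gamma1, gamma2, gamma3} \<subseteq> Gamma_cubes"
proof -
  have "r \<in> Gamma_cubes" if r: "r \<in> {gamma1, gamma2, gamma3}" for r
  proof -
    have "r \<in> PSL2Z"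
      using r by (auto simp: PSL2Z_def gamma1_def gamma2_def gamma3_def intro!: imageI)
    moreover have "r [^]\<^bsub>PGL2Z\<^esub> (3::nat) = r"
      using r by (elim insertE emptyE) (simp_all add: numeral_3_eq_3 gamma1_def gamma2_def gamma3_def)
    ultimately have "r \<in> {X [^]\<^bsub>PGL2Z\<^esub> (3::nat) | X. X \<in> PSL2Z}"
      by force
    then show ?thesis
      unfolding Gamma_cubes_def by (rule generate.incl)
  qed
  then show ?thesis by blast
qed

section \<open>Normality of the subgroup generated by cubes\<close>

lemma PSL2Z_subset: "PSL2Z \<subseteq> carrier PGL2Z"
  by (auto simp: PSL2Z_def invertible_int_iff)

lemma PSL2Z_conj:
  assumes "X \<in> PSL2Z" "Y \<in> carrier PGL2Z"
  shows "Y \<otimes>\<^bsub>PGL2Z\<^esub> X \<otimes>\<^bsub>PGL2Z\<^esub> inv\<^bsub>PGL2Z\<^esub> Y \<in> PSL2Z"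
proof -
  obtain A where A: "X = proj A" "det A = 1" using assms(1) by (auto simp: PSL2Z_def)
  obtain B where B: "Y = proj B" "invertible B" using assms(2) by (metis PGL2Z_cases)
  then obtain C where C: "B ** C = mat 1" "C ** B = mat 1" by (auto simp: invertible_def)
  then have "invertible C" by (auto simp: invertible_def)
  moreover have "invertible A" using A(2) by (simp add: invertible_int_iff)
  ultimately have "Y \<otimes>\<^bsub>PGL2Z\<^esub> X \<otimes>\<^bsub>PGL2Z\<^esub> inv\<^bsub>PGL2Z\<^esub> Y = proj (B ** A ** C)"
    using A(1) B C by (simp add: inv_proj invertible_mult)
  moreover have "det (B ** A ** C) = 1"
    using arg_cong[OF C(1), of det] A(2) by (simp add: det_mul mult.commute)
  ultimately show ?thesis by (auto simp: PSL2Z_def)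
qed

lemma PSL2Z_inv: "X \<in> PSL2Z \<Longrightarrow> inv\<^bsub>PGL2Z\<^esub> X \<in> PSL2Z"
proof -
  assume "X \<in> PSL2Z"
  then obtain A where A: "X = proj A" "det A = 1" by (auto simp: PSL2Z_def)
  then have "invertible A" by (simp add: invertible_int_iff)
  then obtain C where C: "A ** C = mat 1" "C ** A = mat 1" by (auto simp: invertible_def)
  then have "inv\<^bsub>PGL2Z\<^esub> X = proj C"
    unfolding A(1) using \<open>invertible A\<close> by (intro inv_proj) (auto simp: invertible_def)
  moreover have "det C = 1"
    using arg_cong[OF C(1), of det] A(2) by (simp add: det_mul)
  ultimately show ?thesis by (auto simp: PSL2Z_def)
qed

lemma (in group) conj_nat_pow:
  assumes "x \<in> carrier G" "g \<in> carrier G"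
  shows "g \<otimes> x [^] (n::nat) \<otimes> inv g = (g \<otimes> x \<otimes> inv g) [^] n"
proof (induction n)
  case (Suc n)
  have "g \<otimes> x [^] Suc n \<otimes> inv g = (g \<otimes> x [^] n \<otimes> inv g) \<otimes> (g \<otimes> x \<otimes> inv g)"
    using assms by (simp add: m_assoc inv_mult_cancel)
  then show ?case using Suc by simp
qed (use assms in simp)

text \<open>A conjugate of a cube is the cube of the conjugate, which stays in PSL_2(Z) even for
  conjugators of determinant -1.\<close>

lemma normal_Gamma_cubes: "Gamma_cubes \<lhd> PGL2Z"
  unfolding Gamma_cubes_def
proof (rule PGL2Z.normal_generateI)
  show "{X [^]\<^bsub>PGL2Z\<^esub> (3::nat) | X. X \<in> PSL2Z} \<subseteq> carrier PGL2Z"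
    using PSL2Z_subset by auto
next
  fix h g assume h: "h \<in> {X [^]\<^bsub>PGL2Z\<^esub> (3::nat) | X. X \<in> PSL2Z}" and g: "g \<in> carrier PGL2Z"
  then obtain X where X: "X \<in> PSL2Z" "h = X [^]\<^bsub>PGL2Z\<^esub> (3::nat)" by blast
  then have "g \<otimes>\<^bsub>PGL2Z\<^esub> h \<otimes>\<^bsub>PGL2Z\<^esub> inv\<^bsub>PGL2Z\<^esub> g = (g \<otimes>\<^bsub>PGL2Z\<^esub> X \<otimes>\<^bsub>PGL2Z\<^esub> inv\<^bsub>PGL2Z\<^esub> g) [^]\<^bsub>PGL2Z\<^esub> (3::nat)"
    using PGL2Z.conj_nat_pow[of X g] PSL2Z_subset g by auto
  then show "g \<otimes>\<^bsub>PGL2Z\<^esub> h \<otimes>\<^bsub>PGL2Z\<^esub> inv\<^bsub>PGL2Z\<^esub> g \<in> {X [^]\<^bsub>PGL2Z\<^esub> (3::nat) | X. X \<in> PSL2Z}"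
    using PSL2Z_conj[OF X(1) g] by blast
qed

text \<open>The quaternion subgroup of \<open>SL\<^sub>2(\<int>/3)\<close>, the kernel of a homomorphism onto a group of order 3,
  which separates \<open>\<Gamma>\<^sup>3\<close> from the rotations in \<^const>\<open>stab\<close>.\<close>

definition mod3 :: "int^2^2 \<Rightarrow> int^2^2" where
  "mod3 = map_matrix (\<lambda>x. x mod 3)"

definition quaternion_mats :: "(int^2^2) set" where
  "quaternion_mats = {mat2 1 0 0 1, mat2 2 0 0 2, mat2 0 1 2 0, mat2 0 2 1 0,
     mat2 1 1 1 2, mat2 2 2 2 1, mat2 1 2 2 2, mat2 2 1 1 1}"

lemma mod_mult_add_mult_eq:
  "(a mod m * (b mod m) + c mod m * (d mod m)) mod m = (a * b + c * d) mod m"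
  for a :: "'a::euclidean_ring_cancel"
  by (intro mod_add_cong mod_mult_cong) simp_all

lemma mod3_mult: "mod3 (A ** B) = mod3 (mod3 A ** mod3 B)"
  by (cases A; cases B) (simp add: mod3_def mod_mult_add_mult_eq)

lemma quaternion_mats_mult:
  assumes "A \<in> quaternion_mats" "B \<in> quaternion_mats"
  shows "mod3 (A ** B) \<in> quaternion_mats"
  using assms unfolding quaternion_mats_def
  by (elim insertE emptyE) (simp_all add: mod3_def)

text \<open>The quaternion group has index 3 in SL_2(Z/3) and is normal, so it contains all cubes;
  here by inspection of residues.\<close>

lemma mod3_cube:
  assumes "det A = 1"
  shows "mod3 (A ** A ** A) \<in> quaternion_mats"
proof -
  obtain a b c d where A: "A = mat2 a b c d" by (cases A)
  define a' b' c' d' where r: "a' = a mod 3" "b' = b mod 3" "c' = c mod 3" "d' = d mod 3"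
  have "(a' * d' - b' * c') mod 3 = det A mod 3"
    unfolding A r det_mat2 by (intro mod_diff_cong mod_mult_cong) simp_all
  then have det: "(a' * d' - b' * c') mod 3 = 1"
    using assms by simp
  have "a' \<in> {0, 1, 2}" "b' \<in> {0, 1, 2}" "c' \<in> {0, 1, 2}" "d' \<in> {0, 1, 2}"
    by (auto simp: r)
  then have "mod3 (mod3 (mat2 a' b' c' d' ** mat2 a' b' c' d') ** mat2 a' b' c' d') \<in> quaternion_mats"
    using det by (elim insertE emptyE) (simp_all add: mod3_def quaternion_mats_def)
  moreover have "mod3 A = mat2 a' b' c' d'"
    by (simp add: A mod3_def r)
  ultimately show ?thesis
    by (metis mod3_mult)
qed

text \<open>The determinant is kept in the invariant because it excludes the reflections in
  \<open>stab\<close>.\<close>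

lemma Gamma_cubes_mod3:
  assumes "X \<in> Gamma_cubes"
  shows "\<exists>A. X = proj A \<and> det A = 1 \<and> mod3 A \<in> quaternion_mats"
proof -
  have cube: "\<exists>A. X [^]\<^bsub>PGL2Z\<^esub> (3::nat) = proj A \<and> det A = 1 \<and> mod3 A \<in> quaternion_mats"
    if "X \<in> PSL2Z" for X
  proof -
    obtain A where A: "X = proj A" "det A = 1" using \<open>X \<in> PSL2Z\<close> by (auto simp: PSL2Z_def)
    then have "invertible A" by (simp add: invertible_int_iff)
    then have "X [^]\<^bsub>PGL2Z\<^esub> (3::nat) = proj (A ** A ** A)"
      by (simp add: numeral_3_eq_3 A(1) invertible_mult del: proj_int_eq_iff)
    moreover have "det (A ** A ** A) = 1" using A(2) by (simp add: det_mul)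
    ultimately show ?thesis using mod3_cube[OF A(2)] by blast
  qed
  show ?thesis
    using assms unfolding Gamma_cubes_def
  proof (induction X rule: generate.induct)
    case one
    have "mod3 (mat 1) \<in> quaternion_mats" by (simp add: mat_eq_mat2 mod3_def quaternion_mats_def)
    then show ?case using one_PGL2 det_I by blast
  next
    case (incl h)
    then show ?case using cube by blast
  next
    case (inv h)
    then obtain X where X: "X \<in> PSL2Z" "h = X [^]\<^bsub>PGL2Z\<^esub> (3::nat)" by blast
    \<comment> \<open>The inverse of a cube is again a cube, which reduces this case to the previous
      one.\<close>
    then have "inv\<^bsub>PGL2Z\<^esub> h = (inv\<^bsub>PGL2Z\<^esub> X) [^]\<^bsub>PGL2Z\<^esub> (3::nat)"
      using PGL2Z.nat_pow_inv[of X 3] PSL2Z_subset by auto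
    then show ?case using cube[OF PSL2Z_inv[OF X(1)]] by simp
  next
    case (eng h1 h2)
    then obtain A B where AB: "h1 = proj A" "det A = 1" "mod3 A \<in> quaternion_mats"
      "h2 = proj B" "det B = 1" "mod3 B \<in> quaternion_mats" by blast
    then have "h1 \<otimes>\<^bsub>PGL2Z\<^esub> h2 = proj (A ** B)" by (simp add: invertible_int_iff)
    moreover have "det (A ** B) = 1" using AB by (simp add: det_mul)
    moreover have "mod3 (A ** B) \<in> quaternion_mats"
      using AB mod3_mult quaternion_mats_mult by metis
    ultimately show ?case by blast
  qed
qed

text \<open>Determinant 1 removes the three reflections, and reduction modulo 3 the two rotations of
  order 3, with either sign.\<close>

lemma Gamma_cubes_Int_stab: "Gamma_cubes \<inter> stab = {\<one>\<^bsub>PGL2Z\<^esub>}"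
proof -
  have "X = \<one>\<^bsub>PGL2Z\<^esub>" if X: "X \<in> Gamma_cubes" "X \<in> stab" for X
  proof -
    obtain A B where "X = proj A" "det A = 1" "mod3 A \<in> quaternion_mats" "B \<in> stab_mats" "X = proj B"
      using Gamma_cubes_mod3[OF X(1)] X(2) unfolding stab_def by blast
    then have "A = B \<or> A = - B" by auto
    with \<open>B \<in> stab_mats\<close> \<open>det A = 1\<close> \<open>mod3 A \<in> quaternion_mats\<close> have "B = mat 1"
      unfolding stab_mats_def
      by (elim insertE emptyE disjE) (simp_all add: mod3_def quaternion_mats_def mat_eq_mat2)
    then show ?thesis using \<open>X = proj B\<close> by (simp add: one_PGL2)
  qed
  moreover have "\<one>\<^bsub>PGL2Z\<^esub> \<in> Gamma_cubes"
    unfolding Gamma_cubes_def by (rule generate.one)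
  ultimately show ?thesis using one_in_stab by blast
qed

section \<open>Reduction modulo 2\<close>

lemma reduction_mod_2_proj: "reduction_mod_2 (proj A) = proj (map_matrix of_int A)"
proof -
  \<comment> \<open>Signs vanish modulo 2, so both representatives have one image and
    \<open>the_elem\<close> is meaningful.\<close>
  have "map_matrix of_int (- A) = (map_matrix of_int A :: bit^2^2)"
    by (simp add: vec_eq_iff)
  then show ?thesis
    by (simp add: reduction_mod_2_def proj_int)
qed

lemma scalars_bit: "scalars = {mat 1 :: bit^2^2}"
  unfolding scalars_def by auto

lemma proj_bit_eq_iff: "proj A = proj B \<longleftrightarrow> A = B" for A B :: "bit^2^2"
  by (simp add: proj_def r_coset_def scalars_bit)

lemma group_hom_reduction_mod_2: "group_hom PGL2Z PGL2 reduction_mod_2"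
proof (rule group_hom.intro[OF group_PGL2 group_PGL2], unfold group_hom_axioms_def, rule homI)
  have inv: "invertible (map_matrix of_int A :: bit^2^2)" if "invertible A" for A :: "int^2^2"
  proof -
    have "det (map_matrix of_int A :: bit^2^2) = of_int (det A)"
      by (cases A) simp
    then show ?thesis
      using that by (auto simp: invertible_iff_det_dvd_1[of "map_matrix of_int A"] invertible_int_iff)
  qed
  fix X assume "X \<in> carrier PGL2Z"
  then obtain A where A: "invertible A" "X = proj A" by (rule PGL2Z_cases)
  then show "reduction_mod_2 X \<in> carrier PGL2"
    using inv by (simp add: reduction_mod_2_proj)
  fix Y assume "Y \<in> carrier PGL2Z"
  then obtain B where B: "invertible B" "Y = proj B" by (rule PGL2Z_cases)
  have "map_matrix of_int (A ** B) = (map_matrix of_int A ** map_matrix of_int B :: bit^2^2)"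
    by (cases A; cases B) simp
  then show "reduction_mod_2 (X \<otimes>\<^bsub>PGL2Z\<^esub> Y) = reduction_mod_2 X \<otimes>\<^bsub>PGL2\<^esub> reduction_mod_2 Y"
    using A B inv by (simp add: reduction_mod_2_proj)
qed

lemma normal_Pi_2: "Pi_2 \<lhd> PGL2Z"
  unfolding Pi_2_def by (rule group_hom.normal_kernel[OF group_hom_reduction_mod_2])

lemma proj_in_Pi_2_iff:
  "invertible A \<Longrightarrow> proj A \<in> Pi_2 \<longleftrightarrow> map_matrix of_int A = (mat 1 :: bit^2^2)"
  by (simp add: Pi_2_def kernel_def reduction_mod_2_proj one_PGL2 proj_bit_eq_iff)

lemma rhos_in_Pi_2: "{rho1, rho2, rho3} \<subseteq> Pi_2"
  by (simp add: rho1_def rho2_def rho3_def proj_in_Pi_2_iff mat_eq_mat2)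

text \<open>Among the six matrices only the identity reduces to the identity modulo 2.\<close>

lemma Pi_2_Int_stab: "Pi_2 \<inter> stab = {\<one>\<^bsub>PGL2Z\<^esub>}"
proof -
  have "X = \<one>\<^bsub>PGL2Z\<^esub>" if "X \<in> Pi_2" "X \<in> stab" for X
    using that unfolding stab_def stab_mats_def image_insert image_empty
    by (elim insertE emptyE) (simp_all add: proj_in_Pi_2_iff mat_eq_mat2 one_PGL2)
  then show ?thesis
    using one_in_stab subgroup.one_closed[OF normal_imp_subgroup[OF normal_Pi_2]] by blast
qed

section \<open>The classification of normal topographical groups\<close>

theorem theorem10p3:
  shows "{H. topographical H \<and> H \<lhd> PGL2Z} = {Gamma_cubes, Pi_2}
    \<and> Gamma_cubes = generate PGL2Z {gamma1, gamma2, gamma3}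
    \<and> Pi_2 = generate PGL2Z {rho1, rho2, rho3}"
proof -
  \<comment> \<open>\<open>Gamma_cubes\<close> contains a subgroup that already multiplies with
    \<open>stab\<close> to everything, and meets \<open>stab\<close> trivially, so the two coincide;
    likewise for \<open>Pi_2\<close>.\<close>
  have G: "Gamma_cubes = generate PGL2Z {gamma1, gamma2, gamma3}"
    by (rule eq_generate_of_complement[OF normal_imp_subgroup[OF normal_Gamma_cubes]
          Gamma_cubes_Int_stab gammas_in_Gamma_cubes generate_gamma_set_mult_stab])
  have P: "Pi_2 = generate PGL2Z {rho1, rho2, rho3}"
    by (rule eq_generate_of_complement[OF normal_imp_subgroup[OF normal_Pi_2]
          Pi_2_Int_stab rhos_in_Pi_2 generate_rho_set_mult_stab])
  have "topographical Gamma_cubes"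
    using normal_imp_subgroup[OF normal_Gamma_cubes] Gamma_cubes_Int_stab generate_gamma_set_mult_stab
    by (simp add: topographical_iff G)
  moreover have "topographical Pi_2"
    using normal_imp_subgroup[OF normal_Pi_2] Pi_2_Int_stab generate_rho_set_mult_stab
    by (simp add: topographical_iff P)
  moreover have "H = Gamma_cubes \<or> H = Pi_2" if "topographical H" "H \<lhd> PGL2Z" for H
    using normal_complement_stab[OF that(2)] that(1) G P by (auto simp: topographical_iff)
  ultimately show ?thesis
    using normal_Gamma_cubes normal_Pi_2 G P by blast
qed

end
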